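(* Let $X$ be a Banach space and let $Y$ be a closed subspace of $X$. If $X/Y$ is strongly regular and $Y$ has the Ball Small Combination of Slice Property ($BSCSP$), then $X$ has $BSCSP$.
   Context: The Banach spaces $X$ and $Y$ are real and nontrivial; $B_X$ is the closed unit ball of $X$. For a nonempty bounded set $C\subseteq X$, a slice of $C$ is a set $S(C,x^*,\alpha)=\{x\in C: x^*(x)>\sup x^*(C)-\alpha\}$ with $x^*\in X^*$, $\|x^*\|=1$, $\alpha>0$. A convex combination of slices of $C$ is a set $\sum_{i=1}^n\lambda_i S_i=\{\sum_{i=1}^n\lambda_i s_i: s_i\in S_i\}$ where each $S_i$ is a slice of $C$, $0\le\lambda_i\le 1$ and $\sum_{i=1}^n\lambda_i=1$. $X$ has $BSCSP$ if $B_X$ has convex combinations of slices of arbitrarily small diameter (for every $\varepsilon>0$ there is one of diameter less than $\varepsilon$). A Banach space is strongly regular if every nonempty closed, convex and bounded subset of it has convex combinations of slices of arbitrarily small diameter. *)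

theory Defs
  imports "HOL-Analysis.Analysis"
begin

section \<open>Real normed spaces with an explicit carrier\<close>

text \<open>
  The notions below are needed for a space \<open>X\<close>, for a closed subspace \<open>Y\<close> of it with its own
  dual, and for the quotient \<open>X / Y\<close>.  The last two depend on the term \<open>Y\<close> and are
  not types, so the notions are defined once, for spaces with an explicit carrier.
\<close>

record 'v rnspace =
  vcarrier :: "'v set"
  vzero :: 'v
  vadd :: "'v \<Rightarrow> 'v \<Rightarrow> 'v"
  vscale :: "real \<Rightarrow> 'v \<Rightarrow> 'v"
  vnorm :: "'v \<Rightarrow> real"

definition vdiff :: "'v rnspace \<Rightarrow> 'v \<Rightarrow> 'v \<Rightarrow> 'v" where
  "vdiff M x y = vadd M x (vscale M (-1) y)"

text \<open>The value outside the carrier is irrelevant, but the locale \<^locale>\<open>Metric_space\<close> requires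
  a symmetric and nonnegative function on the whole type.\<close>

definition vdist :: "'v rnspace \<Rightarrow> 'v \<Rightarrow> 'v \<Rightarrow> real" where
  "vdist M x y = (if x \<in> vcarrier M \<and> y \<in> vcarrier M then vnorm M (vdiff M x y) else 0)"

locale real_normed_space_on =
  fixes M :: "'v rnspace"
  assumes zero_closed: "vzero M \<in> vcarrier M"
    and add_closed: "\<lbrakk>x \<in> vcarrier M; y \<in> vcarrier M\<rbrakk> \<Longrightarrow> vadd M x y \<in> vcarrier M"
    and scale_closed: "x \<in> vcarrier M \<Longrightarrow> vscale M c x \<in> vcarrier M"
    and add_assoc: "\<lbrakk>x \<in> vcarrier M; y \<in> vcarrier M; z \<in> vcarrier M\<rbrakk>
          \<Longrightarrow> vadd M (vadd M x y) z = vadd M x (vadd M y z)"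
    and add_commute: "\<lbrakk>x \<in> vcarrier M; y \<in> vcarrier M\<rbrakk> \<Longrightarrow> vadd M x y = vadd M y x"
    and add_zero: "x \<in> vcarrier M \<Longrightarrow> vadd M x (vzero M) = x"
    and diff_self: "x \<in> vcarrier M \<Longrightarrow> vdiff M x x = vzero M"
    and scale_add: "\<lbrakk>x \<in> vcarrier M; y \<in> vcarrier M\<rbrakk>
          \<Longrightarrow> vscale M c (vadd M x y) = vadd M (vscale M c x) (vscale M c y)"
    and add_scale: "x \<in> vcarrier M \<Longrightarrow> vscale M (c + d) x = vadd M (vscale M c x) (vscale M d x)"
    and scale_scale: "x \<in> vcarrier M \<Longrightarrow> vscale M c (vscale M d x) = vscale M (c * d) x"
    and scale_one: "x \<in> vcarrier M \<Longrightarrow> vscale M 1 x = x"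
    and norm_eq_zero: "x \<in> vcarrier M \<Longrightarrow> vnorm M x = 0 \<longleftrightarrow> x = vzero M"
    and norm_triangle: "\<lbrakk>x \<in> vcarrier M; y \<in> vcarrier M\<rbrakk>
          \<Longrightarrow> vnorm M (vadd M x y) \<le> vnorm M x + vnorm M y"
    and norm_scale: "x \<in> vcarrier M \<Longrightarrow> vnorm M (vscale M c x) = \<bar>c\<bar> * vnorm M x"

lemma (in real_normed_space_on) Metric_space_vdist: "Metric_space (vcarrier M) (vdist M)"
proof -
  have minus: "vscale M (-1) (vdiff M x y) = vdiff M y x"
    if "x \<in> vcarrier M" "y \<in> vcarrier M" for x y
    using that by (simp add: vdiff_def scale_add scale_closed scale_scale scale_one add_commute)
  have dc: "vdiff M x y \<in> vcarrier M" if "x \<in> vcarrier M" "y \<in> vcarrier M" for x y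
    using that by (simp add: vdiff_def add_closed scale_closed)
  have chain: "vadd M (vdiff M x y) (vdiff M y z) = vdiff M x z"
    if "x \<in> vcarrier M" "y \<in> vcarrier M" "z \<in> vcarrier M" for x y z
  proof -
    have "vadd M (vdiff M x y) (vdiff M y z) =
        vadd M x (vadd M (vadd M (vscale M (-1) y) y) (vscale M (-1) z))"
      using that by (simp add: vdiff_def add_assoc add_closed scale_closed)
    also have "vadd M (vscale M (-1) y) y = vzero M"
      using that diff_self[of y] by (simp add: vdiff_def add_commute scale_closed)
    also have "vadd M (vzero M) (vscale M (-1) z) = vscale M (-1) z"
      using that by (metis add_commute add_zero scale_closed zero_closed)
    finally show ?thesis by (simp add: vdiff_def)
  qed
  have sym: "vnorm M (vdiff M x y) = vnorm M (vdiff M y x)"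
    if "x \<in> vcarrier M" "y \<in> vcarrier M" for x y
    using norm_scale[OF dc[OF that], of "-1"] minus[OF that] by simp
  have tri: "vnorm M (vdiff M x z) \<le> vnorm M (vdiff M x y) + vnorm M (vdiff M y z)"
    if "x \<in> vcarrier M" "y \<in> vcarrier M" "z \<in> vcarrier M" for x y z
    using norm_triangle[OF dc dc] chain that by metis
  have nonneg: "0 \<le> vnorm M (vdiff M x y)" if "x \<in> vcarrier M" "y \<in> vcarrier M" for x y
    using tri[OF that(1) that(2) that(1)] sym[OF that] diff_self[OF that(1)] norm_eq_zero[OF zero_closed]
    by simp
  have eq: "x = y" if "x \<in> vcarrier M" "y \<in> vcarrier M" "vdiff M x y = vzero M" for x y
  proof -
    have "x = vadd M x (vadd M (vscale M (-1) y) y)"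
      using that(1,2) diff_self[of y] by (simp add: vdiff_def add_commute[of _ y] add_zero scale_closed)
    also have "\<dots> = vadd M (vdiff M x y) y"
      using that(1,2) by (simp add: vdiff_def add_assoc scale_closed)
    also have "\<dots> = y" using that by (metis add_commute add_zero zero_closed)
    finally show ?thesis .
  qed
  show ?thesis
    by unfold_locales
      (auto simp: vdist_def nonneg norm_eq_zero dc diff_self intro: sym tri eq)
qed

locale banach_space_on = real_normed_space_on +
  assumes complete: "Metric_space.mcomplete (vcarrier M) (vdist M)"


section \<open>Slices and their convex combinations\<close>

definition vball :: "'v rnspace \<Rightarrow> 'v set" where
  "vball M = {x \<in> vcarrier M. vnorm M x \<le> 1}"

definition vbounded :: "'v rnspace \<Rightarrow> 'v set \<Rightarrow> bool" where
  "vbounded M C \<longleftrightarrow> C \<subseteq> vcarrier M \<and> (\<exists>b. \<forall>x\<in>C. vnorm M x \<le> b)"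

definition vclosed :: "'v rnspace \<Rightarrow> 'v set \<Rightarrow> bool" where
  "vclosed M C \<longleftrightarrow> closedin (Metric_space.mtopology (vcarrier M) (vdist M)) C"

definition vconvex :: "'v rnspace \<Rightarrow> 'v set \<Rightarrow> bool" where
  "vconvex M C \<longleftrightarrow> C \<subseteq> vcarrier M \<and>
     (\<forall>x\<in>C. \<forall>y\<in>C. \<forall>u\<ge>0. \<forall>v\<ge>0. u + v = 1 \<longrightarrow> vadd M (vscale M u x) (vscale M v y) \<in> C)"

definition vdiameter :: "'v rnspace \<Rightarrow> 'v set \<Rightarrow> real" where
  "vdiameter M C = (if C = {} then 0 else SUP (x, y)\<in>C \<times> C. vdist M x y)"

text \<open>Elements of the dual are functions on the whole type; only their values on the carrier
  matter.\<close>

definition vdual :: "'v rnspace \<Rightarrow> ('v \<Rightarrow> real) set" where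
  "vdual M = {f. (\<forall>x\<in>vcarrier M. \<forall>y\<in>vcarrier M. f (vadd M x y) = f x + f y) \<and>
                 (\<forall>c. \<forall>x\<in>vcarrier M. f (vscale M c x) = c * f x) \<and>
                 (\<exists>b. \<forall>x\<in>vcarrier M. \<bar>f x\<bar> \<le> b * vnorm M x)}"

definition vdual_norm :: "'v rnspace \<Rightarrow> ('v \<Rightarrow> real) \<Rightarrow> real" where
  "vdual_norm M f = (SUP x\<in>vball M. \<bar>f x\<bar>)"

definition slice :: "'v set \<Rightarrow> ('v \<Rightarrow> real) \<Rightarrow> real \<Rightarrow> 'v set" where
  "slice C f \<alpha> = {x \<in> C. f x > Sup (f ` C) - \<alpha>}"

definition is_slice :: "'v rnspace \<Rightarrow> 'v set \<Rightarrow> 'v set \<Rightarrow> bool" where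
  "is_slice M C S \<longleftrightarrow> (\<exists>f \<alpha>. f \<in> vdual M \<and> vdual_norm M f = 1 \<and> \<alpha> > 0 \<and> S = slice C f \<alpha>)"

primrec vlincomb :: "'v rnspace \<Rightarrow> (nat \<Rightarrow> real) \<Rightarrow> (nat \<Rightarrow> 'v) \<Rightarrow> nat \<Rightarrow> 'v" where
  "vlincomb M l s 0 = vzero M"
| "vlincomb M l s (Suc n) = vadd M (vlincomb M l s n) (vscale M (l n) (s n))"

definition is_convex_comb_of_slices :: "'v rnspace \<Rightarrow> 'v set \<Rightarrow> 'v set \<Rightarrow> bool" where
  "is_convex_comb_of_slices M C T \<longleftrightarrow>
     (\<exists>(n::nat) l S. (\<forall>i<n. is_slice M C (S i)) \<and> (\<forall>i<n. 0 \<le> l i \<and> l i \<le> 1) \<and>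
        (\<Sum>i<n. l i) = 1 \<and> T = {vlincomb M l s n | s. \<forall>i<n. s i \<in> S i})"

definition has_small_convex_combs_of_slices :: "'v rnspace \<Rightarrow> 'v set \<Rightarrow> bool" where
  "has_small_convex_combs_of_slices M C \<longleftrightarrow>
     (\<forall>\<epsilon>>0. \<exists>T. is_convex_comb_of_slices M C T \<and> vdiameter M T < \<epsilon>)"

definition BSCSP :: "'v rnspace \<Rightarrow> bool" where
  "BSCSP M \<longleftrightarrow> has_small_convex_combs_of_slices M (vball M)"

definition strongly_regular :: "'v rnspace \<Rightarrow> bool" where
  "strongly_regular M \<longleftrightarrow>
     (\<forall>C. C \<noteq> {} \<and> vclosed M C \<and> vconvex M C \<and> vbounded M C \<longrightarrow>
        has_small_convex_combs_of_slices M C)"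


section \<open>Subspaces and quotients\<close>

definition subspace_of_type :: "'a::real_normed_vector set \<Rightarrow> 'a rnspace" where
  "subspace_of_type Y = \<lparr>vcarrier = Y, vzero = 0, vadd = (+), vscale = (*\<^sub>R), vnorm = norm\<rparr>"

definition whole_space :: "'a::real_normed_vector rnspace" where
  "whole_space = subspace_of_type UNIV"

text \<open>The elements of \<open>X / Y\<close> are the cosets \<open>x + Y\<close>.  Adding \<open>Y\<close> in the scalar multiplication
  only matters for the scalar \<open>0\<close>: the elementwise product with \<open>0\<close> would be \<open>{0}\<close>, not \<open>Y\<close>.\<close>

definition coset :: "'a::real_normed_vector set \<Rightarrow> 'a \<Rightarrow> 'a set" where
  "coset Y x = (+) x ` Y"

definition quotient_space :: "'a::real_normed_vector set \<Rightarrow> 'a set rnspace" where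
  "quotient_space Y =
     \<lparr>vcarrier = range (coset Y),
      vzero = Y,
      vadd = (\<lambda>A B. {a + b | a b. a \<in> A \<and> b \<in> B}),
      vscale = (\<lambda>c A. {c *\<^sub>R a + y | a y. a \<in> A \<and> y \<in> Y}),
      vnorm = (\<lambda>A. INF a\<in>A. norm a)\<rparr>"


section \<open>Agreement with the library on subspaces of a type\<close>

lemma subspace_of_type_simps [simp]:
  "vcarrier (subspace_of_type Y) = Y" "vzero (subspace_of_type Y) = 0"
  "vadd (subspace_of_type Y) = (+)" "vscale (subspace_of_type Y) = (*\<^sub>R)"
  "vnorm (subspace_of_type Y) = norm"
  by (simp_all add: subspace_of_type_def)

lemma vdiff_subspace_of_type [simp]: "vdiff (subspace_of_type Y) x y = x - y"
  by (simp add: vdiff_def)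

lemma vdist_subspace_of_type: "x \<in> Y \<Longrightarrow> y \<in> Y \<Longrightarrow> vdist (subspace_of_type Y) x y = dist x y"
  by (simp add: vdist_def dist_norm)

lemma real_normed_space_on_subspace_of_type:
  assumes "subspace Y"
  shows "real_normed_space_on (subspace_of_type Y)"
  using assms
  by unfold_locales
    (auto simp: subspace_0 subspace_add subspace_scale algebra_simps norm_triangle_ineq)

lemma vball_subspace_of_type: "vball (subspace_of_type Y) = cball 0 1 \<inter> Y"
  by (auto simp: vball_def)

lemma vbounded_subspace_of_type: "vbounded (subspace_of_type Y) C \<longleftrightarrow> C \<subseteq> Y \<and> bounded C"
  by (auto simp: vbounded_def bounded_iff)

lemma vconvex_subspace_of_type: "vconvex (subspace_of_type Y) C \<longleftrightarrow> C \<subseteq> Y \<and> convex C"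
  by (auto simp: vconvex_def convex_def)

lemma vdiameter_subspace_of_type:
  assumes "C \<subseteq> Y"
  shows "vdiameter (subspace_of_type Y) C = diameter C"
proof -
  have "(SUP (x, y)\<in>C \<times> C. vdist (subspace_of_type Y) x y) = (SUP (x, y)\<in>C \<times> C. dist x y)"
    using assms by (intro SUP_cong) (auto simp: vdist_subspace_of_type subset_iff)
  then show ?thesis
    by (simp add: vdiameter_def diameter_def)
qed

lemma vlincomb_subspace_of_type: "vlincomb (subspace_of_type Y) l s n = (\<Sum>i<n. l i *\<^sub>R s i)"
  by (induction n) auto

lemma Metric_space_vdist_subspace_of_type: "Metric_space Y (vdist (subspace_of_type Y))"
  by unfold_locales (auto simp: vdist_def dist_triangle simp flip: dist_norm, simp add: dist_commute)

lemma vclosed_subspace_of_type: "vclosed (subspace_of_type Y) C \<longleftrightarrow> closedin (top_of_set Y) C"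
proof -
  interpret E: Submetric UNIV dist Y
    by unfold_locales auto
  interpret S: Metric_space Y "vdist (subspace_of_type Y)"
    by (rule Metric_space_vdist_subspace_of_type)
  have "S.mball = E.sub.mball"
    by (auto simp: fun_eq_iff S.mball_def E.sub.mball_def vdist_subspace_of_type)
  then have "S.mtopology = E.sub.mtopology"
    by (simp add: S.mtopology_def E.sub.mtopology_def S.mopen_def[abs_def] E.sub.mopen_def[abs_def])
  then show ?thesis
    by (simp add: vclosed_def E.mtopology_submetric)
qed

lemma vdual_whole_space: "vdual whole_space = {f. bounded_linear f}"
proof (intro set_eqI iffI)
  fix f :: "'a \<Rightarrow> real" assume "f \<in> vdual whole_space"
  then obtain b where "\<And>x y. f (x + y) = f x + f y" "\<And>c x. f (c *\<^sub>R x) = c * f x"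
    "\<And>x. \<bar>f x\<bar> \<le> b * norm x"
    by (auto simp: vdual_def whole_space_def)
  then show "f \<in> {f. bounded_linear f}"
    using bounded_linear_intro[of f b] by (simp add: mult.commute)
next
  fix f :: "'a \<Rightarrow> real" assume "f \<in> {f. bounded_linear f}"
  then interpret bounded_linear f by simp
  show "f \<in> vdual whole_space"
    using bounded by (auto simp: vdual_def whole_space_def add scaleR mult.commute)
qed

lemma vdual_norm_whole_space:
  assumes "bounded_linear f"
  shows "vdual_norm whole_space f = onorm f"
proof -
  interpret bounded_linear f by fact
  have le: "\<bar>f x\<bar> \<le> onorm f" if "x \<in> cball 0 1" for x
  proof -
    have "\<bar>f x\<bar> \<le> onorm f * norm x" using onorm[OF assms, of x] by simp
    also have "\<dots> \<le> onorm f" using that onorm_pos_le[OF assms] by (simp add: mult_left_le)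
    finally show ?thesis .
  qed
  then have bdd: "bdd_above ((\<lambda>x. \<bar>f x\<bar>) ` cball 0 1)" by (intro bdd_aboveI2)
  have "(SUP x\<in>cball 0 1. \<bar>f x\<bar>) = onorm f"
  proof (rule antisym)
    show "(SUP x\<in>cball 0 1. \<bar>f x\<bar>) \<le> onorm f" by (rule cSUP_least) (auto intro: le)
    show "onorm f \<le> (SUP x\<in>cball 0 1. \<bar>f x\<bar>)"
      unfolding onorm_def
    proof (rule cSUP_least)
      fix x :: 'a
      have eq: "norm (f x) / norm x = \<bar>f (x /\<^sub>R norm x)\<bar>"
        by (simp add: scaleR abs_mult field_simps)
      have "x /\<^sub>R norm x \<in> cball 0 1" by (cases "x = 0") auto
      then show "norm (f x) / norm x \<le> (SUP x\<in>cball 0 1. \<bar>f x\<bar>)"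
        unfolding eq by (rule cSUP_upper[OF _ bdd])
    qed auto
  qed
  then show ?thesis
    by (simp add: vdual_norm_def whole_space_def vball_subspace_of_type)
qed


section \<open>The quotient is a Banach space\<close>

lemma infdist_scaleR_le:
  fixes Y :: "'a::real_normed_vector set"
  assumes Y: "subspace Y"
  shows "infdist (c *\<^sub>R x) Y \<le> \<bar>c\<bar> * infdist x Y"
proof -
  have ne: "Y \<noteq> {}" using subspace_0[OF Y] by auto
  show ?thesis
  proof (cases "c = 0")
    case True then show ?thesis using subspace_0[OF Y] by simp
  next
    case False
    have "infdist (c *\<^sub>R x) Y / \<bar>c\<bar> \<le> infdist x Y"
      unfolding infdist_notempty[OF ne, of x]
    proof (rule cINF_greatest[OF ne])
      fix y assume "y \<in> Y"
      then have "infdist (c *\<^sub>R x) Y \<le> dist (c *\<^sub>R x) (c *\<^sub>R y)"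
        by (intro infdist_le subspace_scale[OF Y])
      then show "infdist (c *\<^sub>R x) Y / \<bar>c\<bar> \<le> dist x y"
        using False by (simp add: dist_norm flip: scaleR_diff_right) (simp add: field_simps)
    qed
    then show ?thesis using False by (simp add: field_simps)
  qed
qed

lemma infdist_scaleR:
  fixes Y :: "'a::real_normed_vector set"
  assumes Y: "subspace Y"
  shows "infdist (c *\<^sub>R x) Y = \<bar>c\<bar> * infdist x Y"
proof (cases "c = 0")
  case True then show ?thesis using subspace_0[OF Y] by simp
next
  case False
  have "infdist x Y \<le> \<bar>inverse c\<bar> * infdist (c *\<^sub>R x) Y"
    using infdist_scaleR_le[OF Y, of "inverse c" "c *\<^sub>R x"] False by simp
  then have "\<bar>c\<bar> * infdist x Y \<le> infdist (c *\<^sub>R x) Y"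
    using False by (simp add: field_simps)
  with infdist_scaleR_le[OF Y, of c x] show ?thesis by simp
qed

lemma infdist_less_obtain:
  fixes Y :: "'a::real_normed_vector set"
  assumes Y: "subspace Y" and "infdist x Y < e"
  obtains y where "y \<in> Y" "norm (x + y) < e"
proof -
  have ne: "Y \<noteq> {}" using subspace_0[OF Y] by auto
  have "\<exists>a\<in>Y. dist x a < e"
    using assms(2) unfolding infdist_notempty[OF ne]
    by (subst (asm) cINF_less_iff[OF ne]) auto
  then obtain a where "a \<in> Y" "dist x a < e" by auto
  then show thesis using that[of "-a"] subspace_neg[OF Y] by (simp add: dist_norm)
qed

lemma infdist_add_le:
  fixes Y :: "'a::real_normed_vector set"
  assumes Y: "subspace Y"
  shows "infdist (x + z) Y \<le> infdist x Y + infdist z Y"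
proof (rule field_le_epsilon)
  fix e :: real assume "e > 0"
  obtain a where a: "a \<in> Y" "norm (x + a) < infdist x Y + e/2"
    using infdist_less_obtain[OF Y, of x "infdist x Y + e/2"] \<open>e > 0\<close> by auto
  obtain b where b: "b \<in> Y" "norm (z + b) < infdist z Y + e/2"
    using infdist_less_obtain[OF Y, of z "infdist z Y + e/2"] \<open>e > 0\<close> by auto
  have "infdist (x + z) Y \<le> dist (x + z) (- (a + b))"
    using a b by (intro infdist_le subspace_neg[OF Y] subspace_add[OF Y])
  also have "\<dots> = norm ((x + a) + (z + b))" by (simp add: dist_norm algebra_simps)
  also have "\<dots> \<le> norm (x + a) + norm (z + b)" by (rule norm_triangle_ineq)
  finally show "infdist (x + z) Y \<le> infdist x Y + infdist z Y + e" using a b by simp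
qed

context
  fixes Y :: "'a::real_normed_vector set"
  assumes Y: "subspace Y"
begin

lemma vcarrier_quotient_space: "vcarrier (quotient_space Y) = range (coset Y)"
  by (simp add: quotient_space_def)

lemma vzero_quotient_space: "vzero (quotient_space Y) = coset Y 0"
  by (simp add: quotient_space_def coset_def)

lemma coset_eq_iff: "coset Y x = coset Y z \<longleftrightarrow> x - z \<in> Y"
proof
  assume "coset Y x = coset Y z"
  then have "x + 0 \<in> coset Y z" using subspace_0[OF Y] unfolding coset_def by blast
  then show "x - z \<in> Y" by (auto simp: coset_def)
next
  assume d: "x - z \<in> Y"
  show "coset Y x = coset Y z"
  proof (intro equalityI subsetI)
    fix u assume "u \<in> coset Y x"
    then obtain y where "y \<in> Y" "u = z + ((x - z) + y)" by (auto simp: coset_def)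
    then show "u \<in> coset Y z" using subspace_add[OF Y d] unfolding coset_def by blast
  next
    fix u assume "u \<in> coset Y z"
    then obtain y where "y \<in> Y" "u = x + (y - (x - z))" by (auto simp: coset_def)
    then show "u \<in> coset Y x" using subspace_diff[OF Y _ d] unfolding coset_def by blast
  qed
qed

lemma vadd_quotient_space:
  "vadd (quotient_space Y) (coset Y x) (coset Y z) = coset Y (x + z)"
proof -
  have "{a + b |a b. a \<in> coset Y x \<and> b \<in> coset Y z} = coset Y (x + z)"
  proof (intro equalityI subsetI)
    fix u assume "u \<in> {a + b |a b. a \<in> coset Y x \<and> b \<in> coset Y z}"
    then obtain p q where pq: "p \<in> Y" "q \<in> Y" and u: "u = (x + p) + (z + q)" by (auto simp: coset_def)
    from u have "u = (x + z) + (p + q)" by (simp add: algebra_simps)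
    then show "u \<in> coset Y (x + z)" using subspace_add[OF Y pq] unfolding coset_def by blast
  next
    fix u assume "u \<in> coset Y (x + z)"
    then obtain p where "p \<in> Y" "u = (x + p) + (z + 0)" by (auto simp: coset_def algebra_simps)
    then show "u \<in> {a + b |a b. a \<in> coset Y x \<and> b \<in> coset Y z}"
      using subspace_0[OF Y] unfolding coset_def by blast
  qed
  then show ?thesis by (simp add: quotient_space_def)
qed

lemma vscale_quotient_space: "vscale (quotient_space Y) c (coset Y x) = coset Y (c *\<^sub>R x)"
proof -
  have "{c *\<^sub>R a + y |a y. a \<in> coset Y x \<and> y \<in> Y} = coset Y (c *\<^sub>R x)"
  proof (intro equalityI subsetI)
    fix u assume "u \<in> {c *\<^sub>R a + y |a y. a \<in> coset Y x \<and> y \<in> Y}"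
    then obtain p q where pq: "p \<in> Y" "q \<in> Y" and u: "u = c *\<^sub>R (x + p) + q" by (auto simp: coset_def)
    from u have "u = c *\<^sub>R x + (c *\<^sub>R p + q)" by (simp add: algebra_simps)
    then show "u \<in> coset Y (c *\<^sub>R x)"
      using subspace_add[OF Y subspace_scale[OF Y pq(1)] pq(2)] unfolding coset_def by blast
  next
    fix u assume "u \<in> coset Y (c *\<^sub>R x)"
    then obtain p where "p \<in> Y" "u = c *\<^sub>R (x + 0) + p" by (auto simp: coset_def)
    then show "u \<in> {c *\<^sub>R a + y |a y. a \<in> coset Y x \<and> y \<in> Y}"
      using subspace_0[OF Y] unfolding coset_def by blast
  qed
  then show ?thesis by (simp add: quotient_space_def)
qed

lemma vnorm_quotient_space: "vnorm (quotient_space Y) (coset Y x) = infdist x Y"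
proof -
  have ne: "Y \<noteq> {}" using subspace_0[OF Y] by auto
  have neg: "uminus ` Y = Y"
    using subspace_neg[OF Y] by (force simp: image_iff)
  have "vnorm (quotient_space Y) (coset Y x) = (INF y\<in>Y. norm (x + y))"
    by (simp add: quotient_space_def coset_def image_image)
  also have "\<dots> = (INF y\<in>uminus ` Y. norm (x + y))"
    by (simp add: neg)
  also have "\<dots> = infdist x Y"
    by (simp add: image_image infdist_notempty[OF ne] dist_norm)
  finally show ?thesis .
qed

lemmas quotient_space_coset_simps =
  vcarrier_quotient_space vzero_quotient_space coset_eq_iff vadd_quotient_space
  vscale_quotient_space vnorm_quotient_space

lemma vdiff_quotient_space:
  "vdiff (quotient_space Y) (coset Y x) (coset Y z) = coset Y (x - z)"
  by (simp add: vdiff_def vadd_quotient_space vscale_quotient_space)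

lemma vdist_quotient_space:
  "vdist (quotient_space Y) (coset Y x) (coset Y z) = infdist (x - z) Y"
  by (simp add: vdist_def vdiff_quotient_space vnorm_quotient_space vcarrier_quotient_space)

lemma real_normed_space_on_quotient_space:
  assumes "closed Y"
  shows "real_normed_space_on (quotient_space Y)"
proof -
  have "infdist x Y = 0 \<longleftrightarrow> x \<in> Y" for x
    using in_closed_iff_infdist_zero[OF assms, of x] subspace_0[OF Y] by auto
  then show ?thesis
    by unfold_locales
      (auto simp: quotient_space_coset_simps vdiff_quotient_space infdist_scaleR[OF Y]
        infdist_add_le[OF Y] subspace_0[OF Y] scaleR_add_right scaleR_add_left add_ac
        intro: rangeI del: equalityI)
qed

lemma banach_space_on_quotient_space:
  assumes "closed Y" and X: "complete (UNIV :: 'a set)"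
  shows "banach_space_on (quotient_space Y)"
proof -
  interpret N: real_normed_space_on "quotient_space Y"
    by (rule real_normed_space_on_quotient_space[OF assms(1)])
  interpret Q: Metric_space "vcarrier (quotient_space Y)" "vdist (quotient_space Y)"
    by (rule N.Metric_space_vdist)
  have "\<exists>q. limitin Q.mtopology \<sigma> q sequentially" if \<sigma>: "Q.MCauchy \<sigma>" for \<sigma>
  proof -
    have "\<forall>k. \<exists>N. \<forall>m n. N \<le> m \<longrightarrow> N \<le> n \<longrightarrow> vdist (quotient_space Y) (\<sigma> m) (\<sigma> n) < (1/2)^k"
      using \<sigma> unfolding Q.MCauchy_def by (meson zero_less_power half_gt_zero_iff zero_less_one)
    then obtain N where N: "\<And>k m n. N k \<le> m \<Longrightarrow> N k \<le> n \<Longrightarrow>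
        vdist (quotient_space Y) (\<sigma> m) (\<sigma> n) < (1/2)^k"
      by metis
    define r where "r k = k + (\<Sum>i\<le>k. N i)" for k
    have r: "strict_mono r" by (auto simp: strict_mono_Suc_iff r_def)
    have rN: "N k \<le> r k" for k
      unfolding r_def using member_le_sum[of k "{..k}" N] by simp
    have close: "vdist (quotient_space Y) (\<sigma> (r k)) (\<sigma> (r (Suc k))) < (1/2)^k" for k
      using rN[of k] strict_mono_less[OF r, of k "Suc k"] by (intro N) auto
    have car: "\<exists>x. \<sigma> n = coset Y x" for n
    proof -
      have "range \<sigma> \<subseteq> range (coset Y)"
        using \<sigma> unfolding Q.MCauchy_def unfolding vcarrier_quotient_space by blast
      then show ?thesis by blast
    qed
    have step: "\<exists>z. \<sigma> (r (Suc k)) = coset Y z \<and> norm (z - x) < (1/2)^k"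
      if x: "\<sigma> (r k) = coset Y x" for k x
    proof -
      obtain z where z: "\<sigma> (r (Suc k)) = coset Y z" using car by blast
      have "infdist (x - z) Y < (1/2)^k"
        using close[of k] by (simp add: x z vdist_quotient_space)
      then obtain y where y: "y \<in> Y" "norm ((x - z) + y) < (1/2)^k"
        using infdist_less_obtain[OF Y] by blast
      have "\<sigma> (r (Suc k)) = coset Y (z - y)"
        using y(1) by (simp add: z coset_eq_iff)
      moreover have "norm ((z - y) - x) = norm ((x - z) + y)"
        by (metis add.commute diff_diff_eq2 minus_diff_eq norm_minus_cancel diff_add_eq)
      ultimately show ?thesis using y(2) by auto
    qed
    obtain x where x: "\<And>k. \<sigma> (r k) = coset Y (x k)"
      and dx: "\<And>k. norm (x (Suc k) - x k) < (1/2)^k"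
      using dependent_nat_choice[of "\<lambda>k x. \<sigma> (r k) = coset Y x"
          "\<lambda>k x z. norm (z - x) < (1/2)^k"] car step by metis
    have tail: "norm (x (n + m) - x n) \<le> 2 * (1/2)^n" for n m
    proof -
      have "norm (x (n + m) - x n) \<le> (2 - 2 * (1/2)^m) * (1/2)^n"
      proof (induction m)
        case (Suc m)
        have "norm (x (n + Suc m) - x n) \<le>
            norm (x (Suc (n + m)) - x (n + m)) + norm (x (n + m) - x n)"
          using norm_triangle_ineq[of "x (Suc (n + m)) - x (n + m)" "x (n + m) - x n"] by simp
        also have "\<dots> \<le> (1/2)^(n + m) + (2 - 2 * (1/2)^m) * (1/2)^n"
          using Suc dx[of "n + m"] by linarith
        also have "\<dots> = (2 - 2 * (1/2)^Suc m) * (1/2)^n"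
          by (simp add: power_add algebra_simps)
        finally show ?case .
      qed simp
      also have "\<dots> \<le> 2 * (1/2)^n" by (intro mult_right_mono) auto
      finally show ?thesis .
    qed
    have "Cauchy x"
    proof (rule metric_CauchyI)
      fix e :: real assume "e > 0"
      then obtain n where n: "(1/2)^n < e / 4" using real_arch_pow_inv[of "e/4" "1/2"] by auto
      have "dist (x p) (x q) < e" if "n \<le> p" "n \<le> q" for p q
      proof -
        have "dist (x p) (x n) \<le> 2 * (1/2)^n" "dist (x q) (x n) \<le> 2 * (1/2)^n"
          using tail[of n "p - n"] tail[of n "q - n"] that by (auto simp: dist_norm)
        then show ?thesis using n dist_triangle2[of "x p" "x q" "x n"] by linarith
      qed
      then show "\<exists>M. \<forall>m\<ge>M. \<forall>n\<ge>M. dist (x m) (x n) < e" by blast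
    qed
    then obtain l where l: "x \<longlonglongrightarrow> l" using X unfolding complete_def by auto
    have "limitin Q.mtopology (\<sigma> \<circ> r) (coset Y l) sequentially"
      unfolding Q.limit_metric_sequentially
    proof (intro conjI allI impI)
      show "coset Y l \<in> vcarrier (quotient_space Y)" by (simp add: vcarrier_quotient_space)
      fix e :: real assume "e > 0"
      then obtain n where n: "\<And>k. k \<ge> n \<Longrightarrow> norm (x k - l) < e"
        using LIMSEQ_D[OF l] by blast
      have "infdist (x k - l) Y \<le> norm (x k - l)" for k
        using infdist_le[OF subspace_0[OF Y], of "x k - l"] by simp
      then have "infdist (x k - l) Y < e" if "k \<ge> n" for k
        using n[OF that] by (rule le_less_trans)
      then show "\<exists>N. \<forall>n\<ge>N. (\<sigma> \<circ> r) n \<in> vcarrier (quotient_space Y) \<and>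
          vdist (quotient_space Y) ((\<sigma> \<circ> r) n) (coset Y l) < e"
        by (auto simp: x vcarrier_quotient_space vdist_quotient_space)
    qed
    then show ?thesis using Q.MCauchy_convergent_subsequence[OF \<sigma> r] by blast
  qed
  then show ?thesis
    by unfold_locales (auto simp: Q.mcomplete_def)
qed

end

end

theory Submission
  imports Defs
begin

text \<open>
  Start from a convex combination \<open>\<Sum>i. \<lambda>\<^sub>i S\<^sub>i\<close> of slices of the unit ball of \<open>Y\<close> with small diameter,
  and extend the functionals that define the \<open>S\<^sub>i\<close> to \<open>X\<close> with the same norm.  The corresponding slices
  of the ball of \<open>X\<close> are too large: they may contain points far from \<open>Y\<close>.  The task is to find,
  inside each of them, a convex combination of slices of the ball of \<open>X\<close> that stays close to \<open>Y\<close>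
  (\<open>contains_slice_comb_near_subspace\<close>).  Its points are then close to the unit ball of \<open>Y\<close>, hence close
  to \<open>S\<^sub>i\<close>, and mixing these combinations with the weights \<open>\<lambda>\<^sub>i\<close> gives a convex combination of slices of
  the ball of \<open>X\<close> inside a small neighbourhood of \<open>\<Sum>i. \<lambda>\<^sub>i S\<^sub>i\<close>.

  Strong regularity of \<open>X / Y\<close> supplies small combinations of slices of convex sets of cosets.  Two steps
  make them useful.  First, a slice of such a set pulls back to the intersection of several
  half-space cuts of the ball of \<open>X\<close>, not to a slice; Bourgain's lemma
  (\<open>contains_slice_comb_weakly_open\<close>) finds a convex combination of slices of the ball inside it.
  Second, strong regularity only says that small combinations exist somewhere, while they are needed
  near the zero coset.  Their points form a convex set, and if that set stayed away from \<open>Y\<close>,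
  a functional vanishing on \<open>Y\<close> would separate the two; applying strong regularity on the side of
  \<open>Y\<close> then gives a contradiction.

  Extension and separation of functionals both come from one version of the Hahn--Banach theorem,
  \<open>mazur_orlicz\<close>.
\<close>


section \<open>Sublinear and linear functionals\<close>

definition sublinear :: "('a::real_vector \<Rightarrow> real) \<Rightarrow> bool" where
  "sublinear p \<longleftrightarrow> (\<forall>x y. p (x + y) \<le> p x + p y) \<and> (\<forall>c\<ge>0. \<forall>x. p (c *\<^sub>R x) = c * p x)"

lemma sublinear_add: "sublinear p \<Longrightarrow> p (x + y) \<le> p x + p y"
  and sublinear_scaleR: "sublinear p \<Longrightarrow> 0 \<le> c \<Longrightarrow> p (c *\<^sub>R x) = c * p x"
  by (auto simp: sublinear_def)

lemma sublinear_0: "sublinear p \<Longrightarrow> p 0 = 0"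
  using sublinear_scaleR[of p 0 0] by simp

lemma sublinear_minus_ge: "sublinear p \<Longrightarrow> - p (- x) \<le> p x"
  using sublinear_add[of p x "- x"] sublinear_0[of p] by simp

lemma sublinearI:
  assumes "\<And>x y. p (x + y) \<le> p x + p y"
    and le: "\<And>c x. c > 0 \<Longrightarrow> p (c *\<^sub>R x) \<le> c * p x" and "p 0 = 0"
  shows "sublinear p"
  unfolding sublinear_def
proof (intro conjI allI impI assms)
  fix c :: real and x assume "c \<ge> 0"
  show "p (c *\<^sub>R x) = c * p x"
  proof (cases "c = 0")
    case False
    with \<open>c \<ge> 0\<close> have "c > 0" by simp
    have "p x \<le> inverse c * p (c *\<^sub>R x)"
      using le[of "inverse c" "c *\<^sub>R x"] \<open>c > 0\<close> by simp
    then show ?thesis using le[OF \<open>c > 0\<close>, of x] \<open>c > 0\<close> by (simp add: field_simps)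
  qed (simp add: assms)
qed

text \<open>
  The functional \<open>q x = inf {p (x - k) + r | (k, r) \<in> K}\<close> is the largest sublinear functional with
  these two bounds.  The hypothesis on \<open>K\<close> keeps the infimum finite.  Extension of a functional,
  separation, and the step from minimal to linear below are all instances of this
  construction, for different cones.
\<close>

lemma sublinear_below_on_cone:
  fixes K :: "('a::real_vector \<times> real) set"
  assumes p: "sublinear p" and K: "convex_cone K"
    and nonneg: "\<And>k r. (k, r) \<in> K \<Longrightarrow> 0 \<le> p (- k) + r"
  obtains q where "sublinear q" "\<And>x. q x \<le> p x" "\<And>k r. (k, r) \<in> K \<Longrightarrow> q k \<le> r"
proof -
  define q where "q x = (INF (k, r)\<in>K. p (x - k) + r)" for x
  have ne: "K \<noteq> {}" and zero: "(0, 0) \<in> K"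
    using convex_cone_contains_0[OF K] by (auto simp: zero_prod_def)
  have lower: "- p (- x) \<le> p (x - k) + r" if "(k, r) \<in> K" for x k r
    using nonneg[OF that] sublinear_add[OF p, of "x - k" "- x"] by simp
  have bdd: "bdd_below ((\<lambda>(k, r). p (x - k) + r) ` K)" for x
    using lower by (intro bdd_belowI2[where m = "- p (- x)"]) auto
  have q_le: "q x \<le> p (x - k) + r" if "(k, r) \<in> K" for x k r
    unfolding q_def using cINF_lower[OF bdd that, of x] by simp
  have q_greatest: "b \<le> q x" if "\<And>k r. (k, r) \<in> K \<Longrightarrow> b \<le> p (x - k) + r" for b x
    unfolding q_def using that by (intro cINF_greatest[OF ne]) auto
  have qp: "q x \<le> p x" for x using q_le[OF zero, of x] by simp
  have "sublinear q"
  proof (rule sublinearI)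
    fix x y
    have "q (x + y) - q y \<le> q x"
    proof (rule q_greatest)
      fix k r assume k: "(k, r) \<in> K"
      have "q (x + y) - (p (x - k) + r) \<le> q y"
      proof (rule q_greatest)
        fix l s assume l: "(l, s) \<in> K"
        have "(k + l, r + s) \<in> K" using convex_cone_add[OF K k l] by simp
        then have "q (x + y) \<le> p ((x - k) + (y - l)) + (r + s)"
          using q_le[of "k + l" "r + s" "x + y"] by (simp add: algebra_simps)
        also have "\<dots> \<le> p (x - k) + p (y - l) + (r + s)"
          using sublinear_add[OF p] by simp
        finally show "q (x + y) - (p (x - k) + r) \<le> p (y - l) + s" by simp
      qed
      then show "q (x + y) - q y \<le> p (x - k) + r" by simp
    qed
    then show "q (x + y) \<le> q x + q y" by simp
  next
    fix c :: real and x assume c: "c > 0"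
    have "q (c *\<^sub>R x) / c \<le> q x"
    proof (rule q_greatest)
      fix k r assume "(k, r) \<in> K"
      then have "(c *\<^sub>R k, c * r) \<in> K" using convex_cone_scaleR[OF K, of c "(k, r)"] c by simp
      then have "q (c *\<^sub>R x) \<le> p (c *\<^sub>R (x - k)) + c * r"
        using q_le[of "c *\<^sub>R k" "c * r" "c *\<^sub>R x"] by (simp add: algebra_simps)
      also have "\<dots> = c * (p (x - k) + r)"
        using sublinear_scaleR[OF p, of c "x - k"] c by (simp add: distrib_left)
      finally show "q (c *\<^sub>R x) / c \<le> p (x - k) + r" using c by (simp add: field_simps)
    qed
    then show "q (c *\<^sub>R x) \<le> c * q x" using c by (simp add: field_simps)
  next
    have "0 \<le> q 0" using nonneg by (intro q_greatest) simp
    then show "q 0 = 0" using qp[of 0] sublinear_0[OF p] by simp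
  qed
  moreover have "q k \<le> r" if "(k, r) \<in> K" for k r
    using q_le[OF that, of k] sublinear_0[OF p] by simp
  ultimately show thesis using qp that by blast
qed

text \<open>
  A sublinear functional is linear once it is odd.  If \<open>q\<close> is minimal, then lowering it along the ray
  through \<open>(- a, - q a)\<close> changes nothing, which gives \<open>q (- a) \<le> - q a\<close>; the other inequality is
  subadditivity.
\<close>

lemma linear_if_minimal_sublinear:
  fixes q :: "'a::real_vector \<Rightarrow> real"
  assumes q: "sublinear q" and minimal: "\<And>u. sublinear u \<Longrightarrow> (\<And>x. u x \<le> q x) \<Longrightarrow> u = q"
  shows "linear q"
proof -
  have minus: "q (- a) = - q a" for a
  proof -
    let ?K = "convex_cone hull {(- a, - q a)}"
    have K: "\<exists>t\<ge>0. k = - (t *\<^sub>R a) \<and> r = - (t * q a)" if "(k, r) \<in> ?K" for k r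
      using that by (auto simp: convex_cone_hull_convex_hull zero_prod_def intro: exI[of _ 0])
    have "0 \<le> q (- k) + r" if "(k, r) \<in> ?K" for k r
      using K[OF that] sublinear_scaleR[OF q] by auto
    then obtain u where u: "sublinear u" "\<And>x. u x \<le> q x" "\<And>k r. (k, r) \<in> ?K \<Longrightarrow> u k \<le> r"
      using sublinear_below_on_cone[OF q convex_cone_convex_cone_hull] by blast
    have "u (- a) \<le> - q a"
      by (intro u(3) hull_inc) simp
    then have "q (- a) \<le> - q a" using minimal[OF u(1,2)] by simp
    then show ?thesis using sublinear_minus_ge[OF q, of a] by simp
  qed
  show ?thesis
  proof (rule linearI)
    fix x y
    have "q (- (x + y)) \<le> q (- x) + q (- y)"
      using sublinear_add[OF q, of "- x" "- y"] by (simp add: add.commute)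
    then show "q (x + y) = q x + q y"
      using sublinear_add[OF q, of x y] unfolding minus by simp
  next
    fix c :: real and x
    show "q (c *\<^sub>R x) = c *\<^sub>R q x"
    proof (cases "c \<ge> 0")
      case True then show ?thesis using sublinear_scaleR[OF q] by simp
    next
      case False
      then show ?thesis using sublinear_scaleR[OF q, of "- c" x] minus[of "c *\<^sub>R x"] by simp
    qed
  qed
qed

text \<open>
  Zorn's lemma provides a minimal sublinear functional below \<open>p\<close>.  The pointwise infimum of a
  chain is finite, because every member \<open>q \<le> p\<close> satisfies \<open>- p (- x) \<le> - q (- x) \<le> q x\<close>.
\<close>

lemma linear_below_sublinear:
  fixes p :: "'a::real_vector \<Rightarrow> real"
  assumes p: "sublinear p"
  obtains g where "linear g" "\<And>x. g x \<le> p x"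
proof -
  let ?S = "{q. sublinear q \<and> q \<le> p}" and ?P = "\<lambda>q u :: 'a \<Rightarrow> real. u \<le> q"
  have "\<exists>m\<in>?S. \<forall>a\<in>?S. ?P m a \<longrightarrow> a = m"
  proof (rule predicate_Zorn)
    show "partial_order_on ?S (relation_of ?P ?S)"
      by (rule partial_order_on_relation_ofI) auto
  next
    fix C assume C: "C \<in> Chains (relation_of ?P ?S)"
    show "\<exists>u\<in>?S. \<forall>a\<in>C. ?P a u"
    proof (cases "C = {}")
      case True then show ?thesis using p by auto
    next
      case False
      have sub: "sublinear q" "q \<le> p" if "q \<in> C" for q
        using C that by (auto simp: Chains_def relation_of_def)
      have chain: "q \<le> r \<or> r \<le> q" if "q \<in> C" "r \<in> C" for q r
        using C that by (auto simp: Chains_def relation_of_def)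
      define u where "u x = (INF q\<in>C. q x)" for x
      have lower: "- p (- x) \<le> q x" if "q \<in> C" for q x
        using sublinear_minus_ge[OF sub(1)[OF that], of x] le_funD[OF sub(2)[OF that], of "- x"] by simp
      have u_le: "u x \<le> q x" if "q \<in> C" for q x
        unfolding u_def using lower
        by (intro cINF_lower that bdd_belowI2[where m = "- p (- x)"]) auto
      have u_greatest: "b \<le> u x" if "\<And>q. q \<in> C \<Longrightarrow> b \<le> q x" for b x
        unfolding u_def using that by (intro cINF_greatest[OF False]) auto
      have "sublinear u"
      proof (rule sublinearI)
        fix x y
        have "u (x + y) - u y \<le> u x"
        proof (rule u_greatest)
          fix q assume q: "q \<in> C"
          have "u (x + y) - q x \<le> u y"
          proof (rule u_greatest)
            fix r assume r: "r \<in> C"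
            obtain m where m: "m \<in> C" "m \<le> q" "m \<le> r" using chain[OF q r] q r by blast
            have "u (x + y) \<le> m x + m y"
              using u_le[OF m(1), of "x + y"] sublinear_add[OF sub(1)[OF m(1)], of x y] by simp
            then show "u (x + y) - q x \<le> r y"
              using le_funD[OF m(2), of x] le_funD[OF m(3), of y] by simp
          qed
          then show "u (x + y) - u y \<le> q x" by simp
        qed
        then show "u (x + y) \<le> u x + u y" by simp
      next
        fix c :: real and x assume c: "c > 0"
        have "u (c *\<^sub>R x) / c \<le> u x"
        proof (rule u_greatest)
          fix q assume q: "q \<in> C"
          show "u (c *\<^sub>R x) / c \<le> q x"
            using u_le[OF q, of "c *\<^sub>R x"] sublinear_scaleR[OF sub(1)[OF q], of c x] c
            by (simp add: field_simps)
        qed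
        then show "u (c *\<^sub>R x) \<le> c * u x" using c by (simp add: field_simps)
      next
        show "u 0 = 0"
          unfolding u_def using False by (simp add: sublinear_0[OF sub(1)] cong: INF_cong_simp)
      qed
      moreover have "u \<le> p"
        using False u_le sub(2) by (meson all_not_in_conv le_fun_def order_trans)
      ultimately show ?thesis using u_le by (intro bexI[of _ u]) (auto simp: le_fun_def)
    qed
  qed
  then obtain m where m: "sublinear m" "m \<le> p"
    and min: "\<And>u. sublinear u \<Longrightarrow> u \<le> p \<Longrightarrow> u \<le> m \<Longrightarrow> u = m" by blast
  have "linear m"
  proof (rule linear_if_minimal_sublinear[OF m(1)])
    fix u assume u: "sublinear u" "\<And>x. u x \<le> m x"
    then have "u \<le> m" by (simp add: le_funI)
    then show "u = m" using min[OF u(1)] m(2) by simp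
  qed
  then show thesis using that[of m] le_funD[OF m(2)] by blast
qed

text \<open>
  A form of the Hahn--Banach theorem in which the prescribed bounds live on a convex cone in
  \<open>X \<times> \<real>\<close>.  For the graph of a functional on a subspace it is the extension theorem; for the
  cone over a convex set placed at a fixed height, it is a separation theorem.
\<close>

theorem mazur_orlicz:
  fixes p :: "'a::real_vector \<Rightarrow> real"
  assumes "sublinear p" "convex_cone K" "\<And>k r. (k, r) \<in> K \<Longrightarrow> 0 \<le> p (- k) + r"
  obtains g where "linear g" "\<And>x. g x \<le> p x" "\<And>k r. (k, r) \<in> K \<Longrightarrow> g k \<le> r"
proof -
  obtain q where q: "sublinear q" "\<And>x. q x \<le> p x" "\<And>k r. (k, r) \<in> K \<Longrightarrow> q k \<le> r"
    using sublinear_below_on_cone[OF assms] by blast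
  obtain g where "linear g" "\<And>x. g x \<le> q x"
    using linear_below_sublinear[OF q(1)] by blast
  then show thesis using q that[of g] order_trans by meson
qed


section \<open>Extension and separation in normed spaces\<close>

lemma infdist_diff_le:
  fixes Y :: "'a::real_normed_vector set"
  assumes "subspace Y"
  shows "infdist (x - z) Y \<le> infdist x Y + infdist z Y"
  using infdist_add_le[OF assms, of x "- z"] infdist_scaleR[OF assms, of "- 1" z] by simp

lemma infdist_le_norm:
  fixes Y :: "'a::real_normed_vector set"
  shows "subspace Y \<Longrightarrow> infdist x Y \<le> norm x"
  using infdist_le[OF subspace_0, of Y x] by simp

lemma infdist_sum_le:
  fixes Y :: "'a::real_normed_vector set"
  assumes Y: "subspace Y" and "\<And>i. i < n \<Longrightarrow> 0 \<le> l i"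
  shows "infdist (\<Sum>i<n::nat. l i *\<^sub>R x i) Y \<le> (\<Sum>i<n. l i * infdist (x i) Y)"
  using assms(2)
proof (induction n)
  case 0
  then show ?case using subspace_0[OF Y] by simp
next
  case (Suc n)
  then show ?case
    using infdist_add_le[OF Y, of "\<Sum>i<n. l i *\<^sub>R x i" "l n *\<^sub>R x n"] infdist_scaleR[OF Y, of "l n" "x n"]
    by fastforce
qed

lemma abs_le_norm_if_linear_le_norm:
  fixes g :: "'a::real_normed_vector \<Rightarrow> real"
  assumes "linear g" "\<And>x. g x \<le> norm x"
  shows "\<bar>g x\<bar> \<le> norm x" "bounded_linear g"
proof -
  show le: "\<bar>g x\<bar> \<le> norm x" for x
    using assms(2)[of x] assms(2)[of "- x"] linear_neg[OF assms(1), of x] by simp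
  interpret linear g by fact
  show "bounded_linear g"
    using le by (intro bounded_linear_intro[of g 1]) (auto simp: add scale)
qed

lemma sublinear_norm: "sublinear (norm :: 'a::real_normed_vector \<Rightarrow> real)"
  by (auto simp: sublinear_def norm_triangle_ineq)

lemma sublinear_infdist:
  fixes Y :: "'a::real_normed_vector set"
  shows "subspace Y \<Longrightarrow> sublinear (\<lambda>x. infdist x Y)"
  by (simp add: sublinear_def infdist_add_le infdist_scaleR)

text \<open>
  The cone is the graph of \<open>f\<close>.  It is symmetric, so that the bound \<open>g \<le> f\<close> on it is an equality.
\<close>

lemma norm_preserving_extension:
  fixes f :: "'a::real_normed_vector \<Rightarrow> real"
  assumes Y: "subspace Y" and f: "f \<in> vdual (subspace_of_type Y)"
    and le: "\<And>y. y \<in> Y \<Longrightarrow> \<bar>f y\<bar> \<le> norm y"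
  obtains g where "bounded_linear g" "\<And>x. \<bar>g x\<bar> \<le> norm x" "\<And>y. y \<in> Y \<Longrightarrow> g y = f y"
proof -
  have add: "f (x + y) = f x + f y" and scale: "f (c *\<^sub>R x) = c * f x" if "x \<in> Y" "y \<in> Y" for x y c
    using f that by (auto simp: vdual_def)
  let ?K = "(\<lambda>y. (y, f y)) ` Y"
  have "convex_cone ?K"
    unfolding convex_cone_iff
    by (auto simp: image_iff zero_prod_def subspace_add[OF Y] subspace_scale[OF Y] add scale
        scale[OF subspace_0[OF Y] subspace_0[OF Y], of 0, simplified] subspace_0[OF Y])
  moreover have "0 \<le> norm (- k) + r" if "(k, r) \<in> ?K" for k r
    using that le by (force simp: abs_le_iff)
  ultimately obtain g where g: "linear g" "\<And>x. g x \<le> norm x" "\<And>k r. (k, r) \<in> ?K \<Longrightarrow> g k \<le> r"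
    using mazur_orlicz[OF sublinear_norm] by blast
  have "g y = f y" if "y \<in> Y" for y
  proof (rule antisym)
    show "g y \<le> f y" using g(3) that by blast
    have "g (- y) \<le> f (- y)" using g(3) subspace_neg[OF Y that] by blast
    then show "f y \<le> g y"
      using linear_neg[OF g(1), of y] scale[OF that that, of "- 1"] by simp
  qed
  then show thesis using that abs_le_norm_if_linear_le_norm[OF g(1,2)] by blast
qed

text \<open>
  The sublinear functional is the distance to \<open>Y\<close>, that is, the quotient norm seen in \<open>X\<close>:
  any linear \<open>g\<close> below it vanishes on \<open>Y\<close>.
\<close>

lemma separation_from_subspace:
  fixes D :: "'a::real_normed_vector set"
  assumes Y: "subspace Y" and D: "convex D" and far: "\<And>x. x \<in> D \<Longrightarrow> \<epsilon> \<le> infdist x Y"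
  obtains g where "bounded_linear g" "\<And>y. y \<in> Y \<Longrightarrow> g y = 0" "\<And>x. x \<in> D \<Longrightarrow> g x \<le> - \<epsilon>"
proof -
  let ?K = "convex_cone hull (D \<times> {- \<epsilon>})"
  have "convex (D \<times> {- \<epsilon>})" using D by (simp add: convex_Times)
  then have K: "(k = 0 \<and> r = 0) \<or> (\<exists>t\<ge>0. \<exists>x\<in>D. k = t *\<^sub>R x \<and> r = - (t * \<epsilon>))"
    if "(k, r) \<in> ?K" for k r
    using that by (auto simp: convex_cone_hull_convex_hull hull_same zero_prod_def)
  have "0 \<le> infdist (- k) Y + r" if "(k, r) \<in> ?K" for k r
    using K[OF that]
  proof
    assume "\<exists>t\<ge>0. \<exists>x\<in>D. k = t *\<^sub>R x \<and> r = - (t * \<epsilon>)"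
    then obtain t x where "t \<ge> 0" "x \<in> D" "k = t *\<^sub>R x" "r = - (t * \<epsilon>)" by blast
    then show ?thesis
      using infdist_scaleR[OF Y, of "- t" x] mult_left_mono[OF far, of x t] by simp
  qed (simp add: infdist_nonneg)
  then obtain g where g: "linear g" "\<And>x. g x \<le> infdist x Y" "\<And>k r. (k, r) \<in> ?K \<Longrightarrow> g k \<le> r"
    using mazur_orlicz[OF sublinear_infdist[OF Y] convex_cone_convex_cone_hull] by blast
  have "bounded_linear g"
    using order_trans[OF g(2) infdist_le_norm[OF Y]] by (rule abs_le_norm_if_linear_le_norm(2)[OF g(1)])
  moreover have "g y = 0" if "y \<in> Y" for y
    using g(2)[of y] g(2)[of "- y"] subspace_neg[OF Y that] that linear_neg[OF g(1), of y] by simp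
  moreover have "g x \<le> - \<epsilon>" if "x \<in> D" for x
    using that by (intro g(3) hull_inc) simp
  ultimately show thesis using that by blast
qed


section \<open>Weighted sums of slices\<close>

lemma image_scaleR_plus: "(*\<^sub>R) c ` (A + B) = (*\<^sub>R) c ` A + (*\<^sub>R) c ` (B :: 'a::real_vector set)"
  by (force simp: set_plus_def scaleR_add_right)

text \<open>
  Weighted Minkowski sums of slices of \<open>C\<close> with nonnegative weights of total \<open>w\<close>.  Allowing every total
  weight makes the notion closed under sums and dilations, so that convex combinations of
  convex combinations need no reindexing; the convex combinations of slices are the case \<open>w = 1\<close>.
\<close>

inductive slice_comb :: "'a::real_normed_vector set \<Rightarrow> real \<Rightarrow> 'a set \<Rightarrow> bool" for C where
  zero: "slice_comb C 0 {0}"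
| add: "slice_comb C w T \<Longrightarrow> is_slice whole_space C S \<Longrightarrow> 0 \<le> l \<Longrightarrow>
    slice_comb C (w + l) (T + (*\<^sub>R) l ` S)"

lemma slice_comb_plus:
  assumes "slice_comb C w T" "slice_comb C v U"
  shows "slice_comb C (w + v) (T + U)"
  using assms(2)
proof induction
  case (add v U S l)
  then show ?case
    using slice_comb.add[OF add.IH, of S l] by (simp add: add.assoc)
qed (simp add: assms(1))

lemma slice_comb_scaleR:
  assumes "slice_comb C w T" "0 \<le> c"
  shows "slice_comb C (c * w) ((*\<^sub>R) c ` T)"
  using assms(1)
proof induction
  case (add w T S l)
  then show ?case
    using slice_comb.add[OF add.IH, of S "c * l"] \<open>0 \<le> c\<close>
    by (simp add: image_scaleR_plus image_image distrib_left)
qed (use slice_comb.zero in simp)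

lemma slice_comb_obtain:
  assumes "slice_comb C w T"
  obtains n l S where "\<And>i. i < n \<Longrightarrow> is_slice whole_space C (S i)" "\<And>i. i < n \<Longrightarrow> 0 \<le> l i"
    "(\<Sum>i<n. l i) = w" "T = (\<Sum>i<n::nat. (*\<^sub>R) (l i) ` S i)"
  using assms
proof (induction arbitrary: thesis)
  case zero
  show ?case by (rule zero[of 0]) auto
next
  case (add w T S l)
  obtain n k R where *: "\<And>i. i < n \<Longrightarrow> is_slice whole_space C (R i)" "\<And>i. i < n \<Longrightarrow> 0 \<le> k i"
    "(\<Sum>i<n. k i) = w" "T = (\<Sum>i<n::nat. (*\<^sub>R) (k i) ` R i)"
    using add.IH by blast
  show ?case
    by (rule add.prems[of "Suc n" "R(n := S)" "k(n := l)"])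
      (use * add.hyps in \<open>auto simp: less_Suc_eq intro!: sum.cong arg_cong2[of _ _ _ _ plus]\<close>)
qed

lemma mem_sum_scaleR_sets_iff:
  "x \<in> (\<Sum>i<n::nat. (*\<^sub>R) (l i) ` S i) \<longleftrightarrow>
    (\<exists>s. (\<forall>i<n. s i \<in> S i) \<and> x = (\<Sum>i<n. l i *\<^sub>R s i))" (is "?lhs \<longleftrightarrow> ?rhs")
proof
  assume ?lhs
  then obtain t where t: "x = sum t {..<n}" "\<forall>i<n. t i \<in> (*\<^sub>R) (l i) ` S i"
    by (auto simp: set_sum_alt)
  then have "\<forall>i. \<exists>y. i < n \<longrightarrow> y \<in> S i \<and> t i = l i *\<^sub>R y" by blast
  then obtain s where "\<forall>i. i < n \<longrightarrow> s i \<in> S i \<and> t i = l i *\<^sub>R s i"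
    unfolding choice_iff by blast
  then show ?rhs using t(1) by (intro exI[of _ s]) simp
next
  assume ?rhs
  then show ?lhs unfolding set_sum_alt[OF finite_lessThan] by blast
qed

lemma is_convex_comb_if_slice_comb:
  assumes "slice_comb C 1 T"
  shows "is_convex_comb_of_slices whole_space C T"
proof -
  obtain n l S where *: "\<And>i. i < n \<Longrightarrow> is_slice whole_space C (S i)" "\<And>i. i < n \<Longrightarrow> 0 \<le> l i"
    "(\<Sum>i<n. l i) = 1" and T: "T = (\<Sum>i<n::nat. (*\<^sub>R) (l i) ` S i)"
    using slice_comb_obtain[OF assms] by metis
  have "l i \<le> 1" if "i < n" for i
    using member_le_sum[of i "{..<n}" l] * that by auto
  moreover have "T = {vlincomb whole_space l s n | s. \<forall>i<n. s i \<in> S i}"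
    unfolding whole_space_def vlincomb_subspace_of_type using T mem_sum_scaleR_sets_iff by blast
  ultimately show ?thesis
    unfolding is_convex_comb_of_slices_def using * by blast
qed

lemma slice_nonempty:
  assumes "is_slice M C S" "C \<noteq> {}"
  shows "S \<noteq> {}"
proof -
  obtain f \<alpha> where "\<alpha> > 0" and S: "S = slice C f \<alpha>"
    using assms(1) by (auto simp: is_slice_def)
  have "\<exists>x\<in>C. Sup (f ` C) - \<alpha> < f x"
  proof (rule ccontr)
    assume "\<not> ?thesis"
    then have "Sup (f ` C) \<le> Sup (f ` C) - \<alpha>"
      using assms(2) by (intro cSUP_least) (auto simp: not_less)
    then show False using \<open>\<alpha> > 0\<close> by simp
  qed
  then show ?thesis by (auto simp: S slice_def)
qed

lemma slice_comb_nonempty: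
  assumes "slice_comb C w T" "C \<noteq> {}"
  shows "T \<noteq> {}"
  using assms(1)
proof induction
  case (add w T S l)
  then show ?case
    using slice_nonempty[OF add.hyps(2) assms(2)] by (auto simp: set_plus_def)
qed simp

definition contains_slice_comb :: "'a::real_normed_vector set \<Rightarrow> real \<Rightarrow> 'a set \<Rightarrow> bool" where
  "contains_slice_comb C w V \<longleftrightarrow> (\<exists>T. slice_comb C w T \<and> T \<subseteq> V)"

lemma contains_slice_comb_mono:
  "contains_slice_comb C w V \<Longrightarrow> V \<subseteq> W \<Longrightarrow> contains_slice_comb C w W"
  unfolding contains_slice_comb_def by blast

lemma contains_slice_comb_plus:
  "contains_slice_comb C w V \<Longrightarrow> contains_slice_comb C v W \<Longrightarrow> contains_slice_comb C (w + v) (V + W)"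
  unfolding contains_slice_comb_def by (meson slice_comb_plus set_plus_mono2)

lemma contains_slice_comb_scaleR:
  "contains_slice_comb C w V \<Longrightarrow> 0 \<le> c \<Longrightarrow> contains_slice_comb C (c * w) ((*\<^sub>R) c ` V)"
  unfolding contains_slice_comb_def by (meson slice_comb_scaleR image_mono)

lemma contains_slice_comb_convex_comb:
  assumes "contains_slice_comb C 1 V" "contains_slice_comb C 1 W" "0 \<le> u" "0 \<le> v" "u + v = 1"
  shows "contains_slice_comb C 1 ((*\<^sub>R) u ` V + (*\<^sub>R) v ` W)"
  using contains_slice_comb_plus[OF contains_slice_comb_scaleR[OF assms(1,3)]
      contains_slice_comb_scaleR[OF assms(2,4)]] assms(5) by simp

lemma contains_slice_comb_sum:
  assumes "\<And>i. i < n \<Longrightarrow> contains_slice_comb C 1 (V i)" "\<And>i. i < n \<Longrightarrow> 0 \<le> l i"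
  shows "contains_slice_comb C (\<Sum>i<n. l i) (\<Sum>i<n::nat. (*\<^sub>R) (l i) ` V i)"
  using assms
proof (induction n)
  case 0
  then show ?case unfolding contains_slice_comb_def using slice_comb.zero by auto
next
  case (Suc n)
  then show ?case
    using contains_slice_comb_plus[OF Suc.IH contains_slice_comb_scaleR[OF Suc.prems(1)[of n], of "l n"]]
    by simp
qed

lemma contains_slice_comb_nonempty:
  "contains_slice_comb C w V \<Longrightarrow> C \<noteq> {} \<Longrightarrow> V \<noteq> {}"
  unfolding contains_slice_comb_def using slice_comb_nonempty by blast

lemma contains_slice_comb_slice:
  assumes "is_slice whole_space C S"
  shows "contains_slice_comb C 1 S"
  using slice_comb.add[OF slice_comb.zero assms, of 1] unfolding contains_slice_comb_def by auto

text \<open>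
  Dividing \<open>f\<close> by its norm and letting \<open>\<alpha>\<close> be the gap between the supremum and the (rescaled) level \<open>b\<close>
  turns a half-space cut into a slice.
\<close>

lemma is_slice_halfspace:
  fixes f :: "'a::real_normed_vector \<Rightarrow> real"
  assumes C: "bounded C" and f: "bounded_linear f" "onorm f \<noteq> 0" and z: "z \<in> C" "b < f z"
  shows "is_slice whole_space C {x \<in> C. b < f x}"
proof -
  have pos: "onorm f > 0" using onorm_pos_le[OF f(1)] f(2) by simp
  define h where "h x = f x / onorm f" for x
  define \<beta> where "\<beta> = b / onorm f"
  have h: "bounded_linear h"
    unfolding h_def using bounded_linear_divide f(1) by (rule bounded_linear_compose)
  have "onorm h = 1"
    using onorm_scaleR[OF f(1), of "inverse (onorm f)"] pos
    by (simp add: h_def[abs_def] divide_inverse mult.commute)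
  moreover have "bdd_above (h ` C)"
    using bounded_linear_image[OF C h] by (rule bounded_imp_bdd_above)
  then have "\<beta> < Sup (h ` C)"
    using less_le_trans[OF divide_strict_right_mono[OF z(2) pos] cSUP_upper[OF z(1), of h, unfolded h_def]]
    by (simp add: \<beta>_def h_def)
  moreover have "{x \<in> C. b < f x} = slice C h (Sup (h ` C) - \<beta>)"
    using pos by (auto simp: slice_def h_def \<beta>_def divide_less_cancel)
  ultimately show ?thesis
    unfolding is_slice_def
    using h by (intro exI[of _ h] exI[of _ "Sup (h ` C) - \<beta>"])
      (simp add: vdual_whole_space vdual_norm_whole_space)
qed

text \<open>
  For \<open>f = 0\<close> the cut is all of \<open>C\<close> and the claim is only that \<open>C\<close> has some slice.  This takes a nonzero
  functional, hence the point \<open>x0\<close>.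
\<close>

lemma contains_slice_comb_halfspace:
  fixes f :: "'a::real_normed_vector \<Rightarrow> real" and x0 :: 'a
  assumes "x0 \<noteq> 0" and C: "bounded C" and f: "bounded_linear f" and z: "z \<in> C" "b < f z"
  shows "contains_slice_comb C 1 {x \<in> C. b < f x}"
proof (cases "onorm f = 0")
  case False
  then show ?thesis
    using is_slice_halfspace[OF C f _ z] by (intro contains_slice_comb_slice) simp
next
  case True
  then have "f x = 0" for x using onorm[OF f, of x] by simp
  then have eq: "{x \<in> C. b < f x} = C" using z by auto
  obtain g where g: "bounded_linear g" "g x0 \<le> - norm x0"
    using separation_from_subspace[of "{0}" "{x0}" "norm x0"] by auto
  then have "onorm g \<noteq> 0" using onorm[OF g(1), of x0] \<open>x0 \<noteq> 0\<close> by auto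
  then have "contains_slice_comb C 1 {x \<in> C. g z - 1 < g x}"
    using is_slice_halfspace[OF C g(1) _ z(1)] by (intro contains_slice_comb_slice) simp
  then show ?thesis unfolding eq by (rule contains_slice_comb_mono) auto
qed


section \<open>Slices in weakly open sets\<close>

text \<open>
  Half-space cuts form a neighbourhood base of an extreme point \<open>e\<close> of \<open>K\<close>.  Since \<open>K - {e}\<close> is convex,
  \<open>e\<close> lies outside the convex hull of \<open>K - ball e r\<close>; in finite dimension this hull is compact, and
  a hyperplane separates \<open>e\<close> from it.
\<close>

lemma extreme_point_halfspace:
  fixes K :: "'e::euclidean_space set"
  assumes K: "compact K" "convex K" and e: "e extreme_point_of K" and "r > 0"
  obtains a b where "b < a \<bullet> e" "\<And>k. k \<in> K \<Longrightarrow> b < a \<bullet> k \<Longrightarrow> k \<in> ball e r"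
proof -
  let ?H = "convex hull (K - ball e r)"
  have "compact ?H" using K(1) by (intro compact_convex_hull compact_diff) auto
  have "convex (K - {e})" using e K(2) extreme_point_of_stillconvex by blast
  then have "?H \<subseteq> K - {e}" using \<open>r > 0\<close> by (intro hull_minimal) auto
  then have "e \<notin> ?H" by blast
  then obtain a b where ab: "a \<bullet> e < b" "\<And>x. x \<in> ?H \<Longrightarrow> a \<bullet> x > b"
    using separating_hyperplane_closed_point[OF convex_convex_hull compact_imp_closed[OF \<open>compact ?H\<close>]]
    by blast
  show thesis
  proof (rule that)
    show "- b < (- a) \<bullet> e" using ab(1) by simp
    fix k assume "k \<in> K" "- b < (- a) \<bullet> k"
    then show "k \<in> ball e r" using ab(2)[OF hull_inc, of k] by fastforce
  qed
qed

text \<open>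
  Bourgain's lemma: a nonempty relatively weakly open subset of a bounded convex set contains a
  convex combination of slices.  Weakly open sets are described by finitely many functionals,
  collected in \<open>\<Phi>\<close>, so the argument takes place in the compact convex set \<open>K = closure (\<Phi> ` C)\<close> of a
  Euclidean space.  The points of \<open>K\<close> all of whose neighbourhoods pull back to sets containing
  such combinations form a convex set.  It contains the extreme points of \<open>K\<close>, whose
  neighbourhoods even contain half-space cuts, and therefore it is \<open>K\<close> by Minkowski's theorem.
\<close>

lemma contains_slice_comb_weakly_open:
  fixes \<Phi> :: "'a::real_normed_vector \<Rightarrow> 'e::euclidean_space" and x0 :: 'a
  assumes "x0 \<noteq> 0" and C: "convex C" "bounded C" and \<Phi>: "bounded_linear \<Phi>"
    and U: "open U" and x: "x \<in> C" "\<Phi> x \<in> U"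
  shows "contains_slice_comb C 1 {z \<in> C. \<Phi> z \<in> U}"
proof -
  interpret \<Phi>: bounded_linear \<Phi> by fact
  define K where "K = closure (\<Phi> ` C)"
  have K: "compact K" "convex K"
    unfolding K_def using C
    by (simp_all add: compact_closure bounded_linear_image[OF _ \<Phi>] convex_closure
        convex_linear_image \<Phi>.linear)
  have \<Phi>K: "\<Phi> z \<in> K" if "z \<in> C" for z
    using that closure_subset[of "\<Phi> ` C"] by (auto simp: K_def)
  let ?P = "{k. \<forall>r>0. contains_slice_comb C 1 {z \<in> C. \<Phi> z \<in> ball k r}}"
  have "convex ?P"
  proof (rule convexI, intro CollectI allI impI)
    fix k l and u v r :: real
    assume k: "k \<in> ?P" and l: "l \<in> ?P" and uv: "0 \<le> u" "0 \<le> v" "u + v = 1" and r: "0 < r"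
    let ?S = "(*\<^sub>R) u ` {z \<in> C. \<Phi> z \<in> ball k r} + (*\<^sub>R) v ` {z \<in> C. \<Phi> z \<in> ball l r}"
    have "contains_slice_comb C 1 ?S"
      using k l r by (intro contains_slice_comb_convex_comb uv) auto
    moreover have "?S \<subseteq> {z \<in> C. \<Phi> z \<in> ball (u *\<^sub>R k + v *\<^sub>R l) r}"
    proof
      fix s assume "s \<in> ?S"
      then obtain y z where yz: "y \<in> C" "dist k (\<Phi> y) < r" "z \<in> C" "dist l (\<Phi> z) < r"
        and s: "s = u *\<^sub>R y + v *\<^sub>R z"
        by (auto simp: set_plus_def)
      have "dist (u *\<^sub>R k + v *\<^sub>R l) (\<Phi> s) = norm (u *\<^sub>R (k - \<Phi> y) + v *\<^sub>R (l - \<Phi> z))"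
        by (simp add: s \<Phi>.add \<Phi>.scaleR dist_norm algebra_simps)
      also have "\<dots> \<le> u * dist k (\<Phi> y) + v * dist l (\<Phi> z)"
        using norm_triangle_ineq[of "u *\<^sub>R (k - \<Phi> y)" "v *\<^sub>R (l - \<Phi> z)"] uv by (simp add: dist_norm)
      also have "\<dots> < r" using yz uv by (intro convex_bound_lt)
      finally show "s \<in> {z \<in> C. \<Phi> z \<in> ball (u *\<^sub>R k + v *\<^sub>R l) r}"
        using convexD[OF C(1) yz(1,3) uv] s by simp
    qed
    ultimately show "contains_slice_comb C 1 {z \<in> C. \<Phi> z \<in> ball (u *\<^sub>R k + v *\<^sub>R l) r}"
      by (rule contains_slice_comb_mono)
  qed
  moreover have "e \<in> ?P" if e: "e extreme_point_of K" for e
  proof (intro CollectI allI impI)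
    fix r :: real assume "r > 0"
    then obtain a b where ab: "b < a \<bullet> e" "\<And>k. k \<in> K \<Longrightarrow> b < a \<bullet> k \<Longrightarrow> k \<in> ball e r"
      using extreme_point_halfspace[OF K e] by metis
    have "open {k. b < a \<bullet> k}" by (rule open_halfspace_gt)
    moreover have "e \<in> closure (\<Phi> ` C)" using e by (simp add: extreme_point_of_def K_def)
    ultimately obtain z where z: "z \<in> C" "b < a \<bullet> \<Phi> z"
      using ab(1) open_Int_closure_eq_empty[of "{k. b < a \<bullet> k}" "\<Phi> ` C"] by auto
    have sub: "{z \<in> C. b < a \<bullet> \<Phi> z} \<subseteq> {z \<in> C. \<Phi> z \<in> ball e r}"
      using ab(2) \<Phi>K by auto
    have "contains_slice_comb C 1 {z \<in> C. b < a \<bullet> \<Phi> z}"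
      using bounded_linear_inner_right_comp[OF \<Phi>] z
      by (intro contains_slice_comb_halfspace[OF \<open>x0 \<noteq> 0\<close> C(2)]) auto
    then show "contains_slice_comb C 1 {z \<in> C. \<Phi> z \<in> ball e r}"
      using sub by (rule contains_slice_comb_mono)
  qed
  ultimately have "convex hull {e. e extreme_point_of K} \<subseteq> ?P"
    by (intro hull_minimal) auto
  then have "K \<subseteq> ?P" by (subst Krein_Milman_Minkowski[OF K])
  then have "\<Phi> x \<in> ?P" using \<Phi>K[OF x(1)] by (rule subsetD)
  moreover obtain r where r: "r > 0" "ball (\<Phi> x) r \<subseteq> U" using U x(2) by (meson openE)
  ultimately have "contains_slice_comb C 1 {z \<in> C. \<Phi> z \<in> ball (\<Phi> x) r}" by blast
  then show ?thesis by (rule contains_slice_comb_mono) (use r(2) in blast)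
qed


section \<open>Slices near a subspace with strongly regular quotient\<close>

lemma vlincomb_quotient_space:
  assumes "subspace Y"
  shows "vlincomb (quotient_space Y) l (\<lambda>i. coset Y (x i)) n = coset Y (\<Sum>i<n. l i *\<^sub>R x i)"
  by (induction n)
    (simp_all add: vzero_quotient_space[OF assms] vadd_quotient_space[OF assms]
      vscale_quotient_space[OF assms])

lemma bounded_linear_vdual_quotient_space:
  assumes Y: "subspace Y" and h: "h \<in> vdual (quotient_space Y)"
  shows "bounded_linear (\<lambda>x. h (coset Y x))"
    and "\<exists>b\<ge>0. \<forall>x. \<bar>h (coset Y x)\<bar> \<le> b * infdist x Y"
proof -
  note simps = vcarrier_quotient_space[OF Y] vadd_quotient_space[OF Y] vscale_quotient_space[OF Y]
    vnorm_quotient_space[OF Y]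
  have add: "h (coset Y (x + y)) = h (coset Y x) + h (coset Y y)"
    and scale: "h (coset Y (c *\<^sub>R x)) = c * h (coset Y x)" for x y c
    using h by (auto simp: vdual_def simps)
  obtain b where "\<And>x. \<bar>h (coset Y x)\<bar> \<le> b * infdist x Y"
    using h by (auto simp: vdual_def simps)
  then have b: "\<bar>h (coset Y x)\<bar> \<le> \<bar>b\<bar> * infdist x Y" for x
    by (rule order_trans) (simp add: mult_right_mono infdist_nonneg)
  then show "\<exists>b\<ge>0. \<forall>x. \<bar>h (coset Y x)\<bar> \<le> b * infdist x Y"
    by (intro exI[of _ "\<bar>b\<bar>"]) simp
  have "norm (h (coset Y x)) \<le> norm x * \<bar>b\<bar>" for x
    using order_trans[OF b[of x] mult_left_mono[OF infdist_le_norm[OF Y, of x], of "\<bar>b\<bar>"]]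
    by (simp add: mult.commute)
  then show "bounded_linear (\<lambda>x. h (coset Y x))"
    by (intro bounded_linear_intro[of _ "\<bar>b\<bar>"]) (auto simp: add scale)
qed

text \<open>
  Strong regularity applies to the closure \<open>D\<close> of the image of \<open>E = {z \<in> C. \<Phi> z \<in> U}\<close> in the quotient.  The
  slices of \<open>D\<close> that it gives are not images of slices of \<open>C\<close>, but their preimages in \<open>E\<close>
  are nonempty and relatively weakly open in \<open>C\<close>.  By Bourgain's lemma they contain convex
  combinations of slices of \<open>C\<close>, and these are mixed with the same weights.
\<close>

lemma contains_slice_comb_small_modulo_subspace:
  fixes Y :: "'a::real_normed_vector set" and \<Phi> :: "'a \<Rightarrow> 'e::euclidean_space" and x0 :: 'a
  assumes Y: "subspace Y" "closed Y" and SR: "strongly_regular (quotient_space Y)"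
    and "x0 \<noteq> 0" and C: "convex C" "bounded C" and \<Phi>: "bounded_linear \<Phi>"
    and U: "open U" "convex U" and x: "x \<in> C" "\<Phi> x \<in> U" and "\<epsilon> > 0"
  obtains V where "V \<subseteq> {z \<in> C. \<Phi> z \<in> U}" "contains_slice_comb C 1 V"
    "\<And>v w. v \<in> V \<Longrightarrow> w \<in> V \<Longrightarrow> infdist (v - w) Y < \<epsilon>"
proof -
  let ?Q = "quotient_space Y"
  interpret \<Phi>: bounded_linear \<Phi> by fact
  interpret N: real_normed_space_on ?Q
    by (rule real_normed_space_on_quotient_space[OF Y])
  interpret Q: Metric_space "vcarrier ?Q" "vdist ?Q"
    by (rule N.Metric_space_vdist)
  note simps = vcarrier_quotient_space[OF Y(1)] vadd_quotient_space[OF Y(1)]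
    vscale_quotient_space[OF Y(1)] vnorm_quotient_space[OF Y(1)] vdist_quotient_space[OF Y(1)]
  define E where "E = {z \<in> C. \<Phi> z \<in> U}"
  define D where "D = Q.mtopology closure_of (coset Y ` E)"
  have "convex E"
    unfolding E_def using convex_Int[OF C(1) convex_linear_vimage[OF \<Phi>.linear U(2)]]
    by (simp add: Int_def vimage_def)
  have D_iff: "coset Y z \<in> D \<longleftrightarrow> (\<forall>r>0. \<exists>e\<in>E. infdist (z - e) Y < r)" for z
    unfolding D_def Q.metric_closure_of Q.in_mball mem_Collect_eq by (auto simp: simps)
  have D_coset: "D \<subseteq> range (coset Y)"
    unfolding D_def Q.metric_closure_of by (auto simp: simps)
  have ED: "coset Y e \<in> D" if "e \<in> E" for e
    unfolding D_iff using that subspace_0[OF Y(1)] by (intro allI impI bexI[of _ e]) auto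
  obtain R where R: "\<And>z. z \<in> C \<Longrightarrow> norm z \<le> R" using C(2) by (auto simp: bounded_iff)
  \<comment> \<open>Passing to the closure costs a little in the bound, and any positive amount will do.\<close>
  have D_bound: "infdist z Y \<le> R + 1" if z: "coset Y z \<in> D" for z
  proof -
    obtain e where e: "e \<in> E" "infdist (z - e) Y < 1"
      using z unfolding D_iff by (meson zero_less_one)
    show ?thesis
      using infdist_add_le[OF Y(1), of "z - e" e] infdist_le_norm[OF Y(1), of e] R[of e] e
      by (simp add: E_def)
  qed
  have "vclosed ?Q D" by (simp add: vclosed_def D_def)
  moreover have "vbounded ?Q D"
    unfolding vbounded_def using D_coset D_bound by (force simp: simps)
  moreover have "vconvex ?Q D"
    unfolding vconvex_def
  proof (intro conjI ballI allI impI)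
    fix p q and u v :: real
    assume "p \<in> D" "q \<in> D" and uv: "0 \<le> u" "0 \<le> v" "u + v = 1"
    then obtain y z where y: "p = coset Y y" "coset Y y \<in> D" and z: "q = coset Y z" "coset Y z \<in> D"
      using D_coset by blast
    have "\<exists>e\<in>E. infdist (u *\<^sub>R y + v *\<^sub>R z - e) Y < r" if "r > 0" for r
    proof -
      obtain a b where a: "a \<in> E" "infdist (y - a) Y < r" and b: "b \<in> E" "infdist (z - b) Y < r"
        using y(2) z(2) \<open>r > 0\<close> unfolding D_iff by blast
      have "infdist (u *\<^sub>R y + v *\<^sub>R z - (u *\<^sub>R a + v *\<^sub>R b)) Y
          = infdist (u *\<^sub>R (y - a) + v *\<^sub>R (z - b)) Y"
        by (simp add: algebra_simps)
      also have "\<dots> \<le> u * infdist (y - a) Y + v * infdist (z - b) Y"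
        using infdist_add_le[OF Y(1), of "u *\<^sub>R (y - a)" "v *\<^sub>R (z - b)"] uv
        by (simp add: infdist_scaleR[OF Y(1)])
      also have "\<dots> < r" using a(2) b(2) uv by (rule convex_bound_lt)
      finally show ?thesis using convexD[OF \<open>convex E\<close> a(1) b(1) uv] by blast
    qed
    then have "coset Y (u *\<^sub>R y + v *\<^sub>R z) \<in> D" unfolding D_iff by blast
    then show "vadd ?Q (vscale ?Q u p) (vscale ?Q v q) \<in> D" by (simp add: y(1) z(1) simps)
  qed (use D_coset in \<open>simp add: simps\<close>)
  moreover have "D \<noteq> {}" using ED[of x] x by (auto simp: E_def)
  ultimately obtain T where T: "is_convex_comb_of_slices ?Q D T" "vdiameter ?Q T < \<epsilon>"
    using SR \<open>\<epsilon> > 0\<close> unfolding strongly_regular_def has_small_convex_combs_of_slices_def by blast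
  then obtain n l S where S: "\<And>i. i < n \<Longrightarrow> is_slice ?Q D (S i)" and l: "\<And>i. i < n \<Longrightarrow> 0 \<le> l i"
    and l1: "(\<Sum>i<n::nat. l i) = 1" and T_eq: "T = {vlincomb ?Q l s n | s. \<forall>i<n. s i \<in> S i}"
    unfolding is_convex_comb_of_slices_def by blast
  have SD: "S i \<subseteq> D" if "i < n" for i
    using S[OF that] by (auto simp: is_slice_def slice_def)
  define P where "P i = {z \<in> E. coset Y z \<in> S i}" for i
  have P: "contains_slice_comb C 1 (P i)" if i: "i < n" for i
  proof -
    obtain h \<alpha> where h: "h \<in> vdual ?Q" and Si: "S i = slice D h \<alpha>"
      using S[OF i] by (auto simp: is_slice_def)
    note bl = bounded_linear_vdual_quotient_space(1)[OF Y(1) h]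
    interpret h: bounded_linear "\<lambda>x. h (coset Y x)" by (rule bl)
    obtain B where B: "B \<ge> 0" "\<And>x. \<bar>h (coset Y x)\<bar> \<le> B * infdist x Y"
      using bounded_linear_vdual_quotient_space(2)[OF Y(1) h] by blast
    define b where "b = Sup (h ` D) - \<alpha>"
    have "S i \<noteq> {}" using slice_nonempty[OF S[OF i] \<open>D \<noteq> {}\<close>] .
    then obtain z where z: "coset Y z \<in> D" "b < h (coset Y z)"
      using D_coset by (auto simp: Si slice_def b_def)
    \<comment> \<open>By density of the image of \<open>E\<close> the slice contains a coset meeting \<open>E\<close>; \<open>r\<close> is the distance
      within which \<open>h\<close>, of norm at most \<open>B\<close>, stays above the level \<open>b\<close>.\<close>
    define r where "r = (h (coset Y z) - b) / (B + 1)"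
    have "r > 0" using z(2) B(1) by (simp add: r_def)
    then obtain e where e: "e \<in> E" "infdist (z - e) Y < r"
      using z(1) unfolding D_iff by blast
    have "h (coset Y z) - h (coset Y e) \<le> B * infdist (z - e) Y"
      using B(2)[of "z - e"] by (simp add: h.diff)
    also have "\<dots> \<le> B * r" using e(2) B(1) by (intro mult_left_mono) auto
    also have "\<dots> < (B + 1) * r" using \<open>r > 0\<close> by simp
    also have "\<dots> = h (coset Y z) - b" using B(1) by (simp add: r_def)
    finally have "b < h (coset Y e)" by simp
    then have "contains_slice_comb C 1 {w \<in> C. (\<Phi> w, h (coset Y w)) \<in> U \<times> {b<..}}"
      using e(1)
      by (intro contains_slice_comb_weakly_open[OF \<open>x0 \<noteq> 0\<close> C, of _ _ e] bounded_linear_Pair \<Phi> bl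
          open_Times U open_greaterThan) (auto simp: E_def)
    moreover have "{w \<in> C. (\<Phi> w, h (coset Y w)) \<in> U \<times> {b<..}} = P i"
      using ED by (auto simp: P_def E_def Si slice_def b_def)
    ultimately show ?thesis by simp
  qed
  let ?V = "\<Sum>i<n. (*\<^sub>R) (l i) ` P i"
  have VT: "coset Y v \<in> T" if v: "v \<in> ?V" for v
  proof -
    obtain p where p: "\<forall>i<n. p i \<in> P i" "v = (\<Sum>i<n. l i *\<^sub>R p i)"
      using v unfolding mem_sum_scaleR_sets_iff by blast
    then show ?thesis
      unfolding T_eq using vlincomb_quotient_space[OF Y(1), of l p n]
      by (intro CollectI exI[of _ "\<lambda>i. coset Y (p i)"]) (auto simp: P_def)
  qed
  \<comment> \<open>Boundedness makes the supremum in the diameter of \<open>T\<close> an honest upper bound.\<close>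
  have T_bound: "\<exists>z. t = coset Y z \<and> infdist z Y \<le> R + 1" if t: "t \<in> T" for t
  proof -
    obtain s where s: "t = vlincomb ?Q l s n" "\<forall>i<n. s i \<in> S i" using t unfolding T_eq by blast
    have "\<forall>i. \<exists>p. i < n \<longrightarrow> s i = coset Y p"
      using s(2) SD D_coset by blast
    then obtain p where p: "\<forall>i. i < n \<longrightarrow> s i = coset Y (p i)"
      unfolding choice_iff by blast
    have "vlincomb ?Q l s m = vlincomb ?Q l (\<lambda>i. coset Y (p i)) m" if "m \<le> n" for m
      using that p by (induction m) auto
    then have "t = coset Y (\<Sum>i<n. l i *\<^sub>R p i)"
      by (simp add: s(1) vlincomb_quotient_space[OF Y(1)])
    moreover have "infdist (p i) Y \<le> R + 1" if "i < n" for i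
      using s(2) SD[OF that] p that by (intro D_bound) auto
    then have "(\<Sum>i<n. l i * infdist (p i) Y) \<le> (\<Sum>i<n. l i * (R + 1))"
      by (intro sum_mono mult_left_mono l) auto
    then have "infdist (\<Sum>i<n. l i *\<^sub>R p i) Y \<le> R + 1"
      using infdist_sum_le[OF Y(1), of n l p] l l1 by (simp flip: sum_distrib_right)
    ultimately show ?thesis by blast
  qed
  have bdd: "bdd_above ((\<lambda>(s, t). vdist ?Q s t) ` (T \<times> T))"
  proof (rule bdd_aboveI2)
    fix st assume "st \<in> T \<times> T"
    then obtain s t where "st = (coset Y s, coset Y t)" "infdist s Y \<le> R + 1" "infdist t Y \<le> R + 1"
      using T_bound by blast
    then show "(case st of (s, t) \<Rightarrow> vdist ?Q s t) \<le> 2 * (R + 1)"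
      using infdist_diff_le[OF Y(1), of s t] by (simp add: simps)
  qed
  show thesis
  proof (rule that)
    show "contains_slice_comb C 1 ?V"
      using contains_slice_comb_sum[of n C P l] P l l1 by simp
    show "?V \<subseteq> {z \<in> C. \<Phi> z \<in> U}"
    proof
      fix v assume "v \<in> ?V"
      then obtain p where p: "\<forall>i<n. p i \<in> P i" "v = (\<Sum>i<n. l i *\<^sub>R p i)"
        unfolding mem_sum_scaleR_sets_iff by blast
      then have "v \<in> E"
        unfolding p(2) using l l1 by (intro convex_sum[OF _ \<open>convex E\<close>]) (auto simp: P_def)
      then show "v \<in> {z \<in> C. \<Phi> z \<in> U}" by (simp add: E_def)
    qed
    fix v w assume vw: "v \<in> ?V" "w \<in> ?V"
    have "infdist (v - w) Y = vdist ?Q (coset Y v) (coset Y w)" by (simp add: simps)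
    also have "\<dots> \<le> vdiameter ?Q T"
      using cSUP_upper[OF _ bdd, of "(coset Y v, coset Y w)"] VT[OF vw(1)] VT[OF vw(2)]
      by (auto simp: vdiameter_def)
    finally show "infdist (v - w) Y < \<epsilon>" using T(2) by simp
  qed
qed

text \<open>
  This is the density of the small combinations of slices in a strongly regular
  set, carried out upstairs in \<open>X\<close>.  The points lying in combinations of slices that are contained in
  \<open>{z \<in> C. s < f z}\<close> and are small modulo \<open>Y\<close> form a convex set \<open>D\<close>.  If \<open>D\<close> stayed away from \<open>Y\<close>, a functional \<open>g\<close>
  vanishing on \<open>Y\<close> would be at most \<open>- (\<epsilon> / 2)\<close> on \<open>D\<close>.  But the cut \<open>g > - (\<epsilon> / 2)\<close> still contains
  \<open>y\<close>, and the preceding lemma finds a small combination of slices in it, a contradiction.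
\<close>

lemma contains_slice_comb_near_subspace:
  fixes Y :: "'a::real_normed_vector set" and x0 :: 'a
  assumes Y: "subspace Y" "closed Y" and SR: "strongly_regular (quotient_space Y)"
    and "x0 \<noteq> 0" and C: "convex C" "bounded C" and f: "bounded_linear (f :: 'a \<Rightarrow> real)"
    and y: "y \<in> C" "y \<in> Y" "s < f y" and "\<epsilon> > 0"
  obtains V where "V \<subseteq> {z \<in> C. s < f z}" "contains_slice_comb C 1 V"
    "\<And>v. v \<in> V \<Longrightarrow> infdist v Y < \<epsilon>"
proof -
  interpret f: bounded_linear f by fact
  let ?A = "{z \<in> C. s < f z}"
  define small where "small V \<longleftrightarrow> V \<subseteq> ?A \<and> contains_slice_comb C 1 V \<and>
      (\<forall>v\<in>V. \<forall>w\<in>V. infdist (v - w) Y < \<epsilon> / 2)" for V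
  have "convex ?A"
    using convex_Int[OF C(1) convex_linear_vimage[OF f.linear convex_real_interval(3)[of s]]]
    by (simp add: Int_def vimage_def)
  have mix: "small ((*\<^sub>R) u ` V + (*\<^sub>R) v ` W)"
    if V: "small V" and W: "small W" and uv: "0 \<le> u" "0 \<le> v" "u + v = 1" for u v V W
    unfolding small_def
  proof (intro conjI ballI)
    show "contains_slice_comb C 1 ((*\<^sub>R) u ` V + (*\<^sub>R) v ` W)"
      using V W uv by (intro contains_slice_comb_convex_comb) (auto simp: small_def)
    show "(*\<^sub>R) u ` V + (*\<^sub>R) v ` W \<subseteq> ?A"
    proof
      fix t assume "t \<in> (*\<^sub>R) u ` V + (*\<^sub>R) v ` W"
      then obtain a b where "a \<in> V" "b \<in> W" "t = u *\<^sub>R a + v *\<^sub>R b" by (auto simp: set_plus_def)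
      then show "t \<in> ?A" using V W convexD[OF \<open>convex ?A\<close> _ _ uv, of a b] unfolding small_def by blast
    qed
    fix t t' assume "t \<in> (*\<^sub>R) u ` V + (*\<^sub>R) v ` W" "t' \<in> (*\<^sub>R) u ` V + (*\<^sub>R) v ` W"
    then obtain a b a' b' where ab: "a \<in> V" "b \<in> W" "a' \<in> V" "b' \<in> W"
      and t: "t = u *\<^sub>R a + v *\<^sub>R b" "t' = u *\<^sub>R a' + v *\<^sub>R b'"
      by (auto simp: set_plus_def)
    have "infdist (t - t') Y = infdist (u *\<^sub>R (a - a') + v *\<^sub>R (b - b')) Y"
      by (simp add: t algebra_simps)
    also have "\<dots> \<le> u * infdist (a - a') Y + v * infdist (b - b') Y"
      using infdist_add_le[OF Y(1), of "u *\<^sub>R (a - a')" "v *\<^sub>R (b - b')"] uv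
      by (simp add: infdist_scaleR[OF Y(1)])
    also have "\<dots> < \<epsilon> / 2"
      using V W ab uv by (intro convex_bound_lt) (auto simp: small_def)
    finally show "infdist (t - t') Y < \<epsilon> / 2" .
  qed
  define D where "D = \<Union> {V. small V}"
  have "convex D"
  proof (rule convexI)
    fix a b and u v :: real
    assume "a \<in> D" "b \<in> D" and uv: "0 \<le> u" "0 \<le> v" "u + v = 1"
    then obtain V W where "small V" "small W" "a \<in> V" "b \<in> W" unfolding D_def by blast
    moreover from this have "u *\<^sub>R a + v *\<^sub>R b \<in> (*\<^sub>R) u ` V + (*\<^sub>R) v ` W" by blast
    ultimately show "u *\<^sub>R a + v *\<^sub>R b \<in> D" unfolding D_def using mix uv by blast
  qed
  have "\<exists>d\<in>D. infdist d Y < \<epsilon> / 2"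
  proof (rule ccontr)
    assume "\<not> ?thesis"
    then have "\<epsilon> / 2 \<le> infdist d Y" if "d \<in> D" for d using that by force
    then obtain g where g: "bounded_linear g" "\<And>y. y \<in> Y \<Longrightarrow> g y = 0" "\<And>d. d \<in> D \<Longrightarrow> g d \<le> - (\<epsilon> / 2)"
      using separation_from_subspace[OF Y(1) \<open>convex D\<close>] by metis
    let ?U = "{s<..} \<times> {- (\<epsilon> / 2)<..}"
    obtain V where V: "V \<subseteq> {z \<in> C. (f z, g z) \<in> ?U}" "contains_slice_comb C 1 V"
      "\<And>v w. v \<in> V \<Longrightarrow> w \<in> V \<Longrightarrow> infdist (v - w) Y < \<epsilon> / 2"
    proof (rule contains_slice_comb_small_modulo_subspace[OF Y SR \<open>x0 \<noteq> 0\<close> C])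
      show "bounded_linear (\<lambda>z. (f z, g z))" by (intro bounded_linear_Pair f g)
      show "open ?U" "convex ?U" by (intro open_Times convex_Times open_greaterThan convex_real_interval)+
      show "y \<in> C" "(f y, g y) \<in> ?U" "\<epsilon> / 2 > 0" using y g(2) \<open>\<epsilon> > 0\<close> by auto
    qed blast
    then have "small V" unfolding small_def by auto
    moreover obtain v where v: "v \<in> V"
      using contains_slice_comb_nonempty[OF V(2)] y(1) by blast
    ultimately have "g v \<le> - (\<epsilon> / 2)" by (intro g(3)) (auto simp: D_def)
    then show False using V(1) v by auto
  qed
  then obtain V d where V: "small V" and d: "d \<in> V" "infdist d Y < \<epsilon> / 2" unfolding D_def by blast
  show thesis
  proof (rule that)
    show "V \<subseteq> ?A" "contains_slice_comb C 1 V" using V by (auto simp: small_def)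
    fix v assume "v \<in> V"
    then have "infdist (v - d) Y < \<epsilon> / 2" using V d(1) by (simp add: small_def)
    then show "infdist v Y < \<epsilon>"
      using infdist_add_le[OF Y(1), of "v - d" d] d(2) by simp
  qed
qed


section \<open>From the ball of the subspace to the ball of the space\<close>

lemma abs_le_norm_if_vdual_norm_1:
  assumes Y: "subspace Y" and f: "f \<in> vdual (subspace_of_type Y)"
    and norm: "vdual_norm (subspace_of_type Y) f = 1" and y: "y \<in> Y"
  shows "\<bar>f y\<bar> \<le> norm y"
proof -
  have "\<exists>b. \<forall>y\<in>Y. \<bar>f y\<bar> \<le> b * norm y" using f by (simp add: vdual_def)
  then obtain b where b: "\<And>y. y \<in> Y \<Longrightarrow> \<bar>f y\<bar> \<le> b * norm y" by blast
  have scale: "f (c *\<^sub>R y) = c * f y" for c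
    using f y by (auto simp: vdual_def)
  have "\<bar>f z\<bar> \<le> \<bar>b\<bar>" if z: "z \<in> cball 0 1 \<inter> Y" for z
  proof -
    have "\<bar>f z\<bar> \<le> b * norm z" using b z by simp
    also have "\<dots> \<le> \<bar>b\<bar> * norm z" by (intro mult_right_mono) auto
    also have "\<dots> \<le> \<bar>b\<bar>" using z by (simp add: mult_left_le)
    finally show ?thesis .
  qed
  then have bdd: "bdd_above ((\<lambda>z. \<bar>f z\<bar>) ` (cball 0 1 \<inter> Y))" by (rule bdd_aboveI2)
  let ?z = "inverse (norm y) *\<^sub>R y"
  have "?z \<in> cball 0 1 \<inter> Y" using subspace_scale[OF Y y] by (cases "y = 0") auto
  then have "\<bar>f ?z\<bar> \<le> 1"
    using cSUP_upper[OF _ bdd] norm by (simp add: vdual_norm_def vball_subspace_of_type)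
  then show ?thesis
    using scale[of 0] by (cases "y = 0") (auto simp: scale abs_mult field_simps)
qed

text \<open>
  A point of \<open>Y\<close> close to \<open>v\<close> may leave the unit ball by less than \<open>e\<close>.  Pulling it back radially costs at
  most another \<open>e\<close>.
\<close>

lemma near_subspace_imp_near_unit_ball:
  fixes Y :: "'a::real_normed_vector set"
  assumes Y: "subspace Y" and v: "norm v \<le> 1" "infdist v Y < e"
  obtains u where "u \<in> Y" "norm u \<le> 1" "norm (v - u) < 2 * e"
proof -
  obtain y where y: "y \<in> Y" "norm (v + y) < e" using infdist_less_obtain[OF Y v(2)] by blast
  define m where "m = max 1 (norm y)"
  define u where "u = - (y /\<^sub>R m)"
  have m: "m \<ge> 1" "norm y \<le> m" by (auto simp: m_def)
  have "norm y \<le> 1 + e"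
    using norm_triangle_ineq4[of "v + y" v] v(1) y(2) by simp
  moreover have "0 < e" using y(2) norm_ge_zero[of "v + y"] by linarith
  ultimately have "m - 1 \<le> e" by (simp add: m_def)
  have "norm (- y - u) = norm y / m * (m - 1)"
  proof -
    have "- y - u = (1 / m - 1) *\<^sub>R y" by (simp add: u_def scaleR_left_diff_distrib divide_inverse)
    then show ?thesis using m(1) by (simp add: abs_if field_simps)
  qed
  also have "\<dots> \<le> 1 * (m - 1)" using m by (intro mult_right_mono) auto
  finally have "norm (- y - u) \<le> e" using \<open>m - 1 \<le> e\<close> by simp
  then have "norm (v - u) < 2 * e"
    using norm_triangle_ineq[of "v + y" "- y - u"] y(2) by simp
  moreover have "u \<in> Y" unfolding u_def by (intro subspace_neg subspace_scale Y y)
  moreover have "norm u \<le> 1" using m by (simp add: u_def field_simps)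
  ultimately show thesis using that by blast
qed

theorem proposition4p2:
  fixes Y :: "'a::banach set"
  assumes "subspace Y" and "closed Y" and "Y \<noteq> {0}"
    and "strongly_regular (quotient_space Y)"
    and "BSCSP (subspace_of_type Y)"
  shows "BSCSP (whole_space :: 'a rnspace)"
proof -
  let ?B = "cball 0 1 :: 'a set" and ?M = "subspace_of_type Y"
  note Y = \<open>subspace Y\<close>
  obtain x0 where x0: "x0 \<in> Y" "x0 \<noteq> 0" using \<open>Y \<noteq> {0}\<close> subspace_0[OF Y] by blast
  have ball_Y: "vball ?M = ?B \<inter> Y" and ball_X: "vball whole_space = ?B"
    by (auto simp: vball_subspace_of_type whole_space_def)
  have "\<exists>T. is_convex_comb_of_slices whole_space ?B T \<and> vdiameter whole_space T < \<epsilon>"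
    if "\<epsilon> > 0" for \<epsilon> :: real
  proof -
    obtain T\<^sub>Y where T\<^sub>Y: "is_convex_comb_of_slices ?M (?B \<inter> Y) T\<^sub>Y" "vdiameter ?M T\<^sub>Y < \<epsilon> / 2"
      using assms(5) \<open>\<epsilon> > 0\<close> unfolding BSCSP_def has_small_convex_combs_of_slices_def ball_Y
      by (meson half_gt_zero)
    then obtain n l S where S: "\<And>i. i < n \<Longrightarrow> is_slice ?M (?B \<inter> Y) (S i)"
      and l: "\<And>i. i < n \<Longrightarrow> 0 \<le> l i" and l1: "(\<Sum>i<n::nat. l i) = 1"
      and T\<^sub>Y_eq: "T\<^sub>Y = {\<Sum>i<n. l i *\<^sub>R s i | s. \<forall>i<n. s i \<in> S i}"
      unfolding is_convex_comb_of_slices_def vlincomb_subspace_of_type by blast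
    have near: "\<exists>V. contains_slice_comb ?B 1 V \<and> (\<forall>v\<in>V. \<exists>s\<in>S i. norm (v - s) < \<epsilon> / 8)"
      if i: "i < n" for i
    proof -
      obtain f \<alpha> where f: "f \<in> vdual ?M" "vdual_norm ?M f = 1" "\<alpha> > 0" and Si: "S i = slice (?B \<inter> Y) f \<alpha>"
        using S[OF i] by (auto simp: is_slice_def)
      \<comment> \<open>The slice of the ball of \<open>X\<close> given by an extension of \<open>f\<close> is taken with \<open>\<alpha> / 2\<close>, so that moving its
        points by \<open>\<delta>\<close> into \<open>Y\<close> ends in the slice \<open>S i\<close> itself.\<close>
      obtain g where g: "bounded_linear g" "\<And>x. \<bar>g x\<bar> \<le> norm x" "\<And>y. y \<in> Y \<Longrightarrow> g y = f y"
        using norm_preserving_extension[OF Y f(1) abs_le_norm_if_vdual_norm_1[OF Y f(1,2)]] by blast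
      interpret g: bounded_linear g by (rule g(1))
      define s where "s = Sup (f ` (?B \<inter> Y)) - \<alpha>"
      define \<delta> where "\<delta> = min (\<alpha> / 2) (\<epsilon> / 8)"
      have \<delta>: "\<delta> > 0" "\<delta> \<le> \<alpha> / 2" "\<delta> \<le> \<epsilon> / 8" using \<open>\<alpha> > 0\<close> \<open>\<epsilon> > 0\<close> by (auto simp: \<delta>_def)
      have "is_slice ?M (?B \<inter> Y) (slice (?B \<inter> Y) f (\<alpha> / 2))"
        using f half_gt_zero[OF f(3)] unfolding is_slice_def by blast
      moreover have "0 \<in> ?B \<inter> Y" using subspace_0[OF Y] by simp
      then have "?B \<inter> Y \<noteq> {}" by blast
      ultimately have "slice (?B \<inter> Y) f (\<alpha> / 2) \<noteq> {}" by (rule slice_nonempty)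
      then obtain y where y: "y \<in> ?B" "y \<in> Y" "s + \<alpha> / 2 < f y" by (auto simp: slice_def s_def)
      have gy: "s + \<alpha> / 2 < g y" using y g(3) by simp
      have "\<delta> / 2 > 0" using \<delta> by simp
      then obtain V where V: "V \<subseteq> {z \<in> ?B. s + \<alpha> / 2 < g z}" "contains_slice_comb ?B 1 V"
        "\<And>v. v \<in> V \<Longrightarrow> infdist v Y < \<delta> / 2"
        using contains_slice_comb_near_subspace[OF Y assms(2,4) x0(2) convex_cball bounded_cball
            g(1) y(1,2) gy] by blast
      have "\<exists>t\<in>S i. norm (v - t) < \<epsilon> / 8" if v: "v \<in> V" for v
      proof -
        obtain u where u: "u \<in> Y" "norm u \<le> 1" "norm (v - u) < \<delta>"
          using near_subspace_imp_near_unit_ball[OF Y _ V(3)[OF v]] V(1) v by force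
        have "g v - g u \<le> norm (v - u)" using g(2)[of "v - u"] by (simp add: g.diff)
        then have "s < f u" using V(1) v u \<delta> g(3)[of u] by auto
        then have "u \<in> S i" using u by (simp add: Si slice_def s_def)
        then show ?thesis using u \<delta> by (intro bexI[of _ u]) auto
      qed
      then show ?thesis using V(2) by blast
    qed
    then have "\<forall>i. \<exists>V. i < n \<longrightarrow>
        contains_slice_comb ?B 1 V \<and> (\<forall>v\<in>V. \<exists>s\<in>S i. norm (v - s) < \<epsilon> / 8)" by blast
    then obtain V where V: "\<And>i. i < n \<Longrightarrow> contains_slice_comb ?B 1 (V i)"
      and VS: "\<And>i v. i < n \<Longrightarrow> v \<in> V i \<Longrightarrow> \<exists>s\<in>S i. norm (v - s) < \<epsilon> / 8"
      unfolding choice_iff by blast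
    obtain T where T: "slice_comb ?B 1 T" "T \<subseteq> (\<Sum>i<n. (*\<^sub>R) (l i) ` V i)"
      using contains_slice_comb_sum[of n ?B V l] V l l1 by (auto simp: contains_slice_comb_def)
    have SB: "S i \<subseteq> ?B \<inter> Y" if "i < n" for i
      using S[OF that] by (auto simp: is_slice_def slice_def)
    have conv: "convex (?B \<inter> Y)" by (intro convex_Int convex_cball subspace_imp_convex Y)
    have "T\<^sub>Y \<subseteq> ?B \<inter> Y"
    proof
      fix t assume "t \<in> T\<^sub>Y"
      then obtain s where s: "t = (\<Sum>i<n. l i *\<^sub>R s i)" "\<forall>i<n. s i \<in> S i" unfolding T\<^sub>Y_eq by blast
      show "t \<in> ?B \<inter> Y"
        unfolding s(1) using s(2) l SB by (intro convex_sum[OF finite_lessThan conv l1]) blast+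
    qed
    then have "T\<^sub>Y \<subseteq> Y" "bounded T\<^sub>Y" using bounded_subset[OF bounded_cball, of T\<^sub>Y] by blast+
    then have T\<^sub>Y_diam: "diameter T\<^sub>Y < \<epsilon> / 2" "bounded T\<^sub>Y"
      using T\<^sub>Y(2) by (simp_all add: vdiameter_subspace_of_type)
    have approx: "\<exists>s\<in>T\<^sub>Y. norm (t - s) \<le> \<epsilon> / 8" if t: "t \<in> T" for t
    proof -
      obtain v where v: "\<forall>i<n. v i \<in> V i" "t = (\<Sum>i<n. l i *\<^sub>R v i)"
        using subsetD[OF T(2) t] unfolding mem_sum_scaleR_sets_iff by blast
      have "\<forall>i. \<exists>s. i < n \<longrightarrow> s \<in> S i \<and> norm (v i - s) < \<epsilon> / 8" using v(1) VS by blast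
      then obtain s where s: "\<And>i. i < n \<Longrightarrow> s i \<in> S i" "\<And>i. i < n \<Longrightarrow> norm (v i - s i) < \<epsilon> / 8"
        unfolding choice_iff by blast
      have "norm (l i *\<^sub>R (v i - s i)) \<le> l i * (\<epsilon> / 8)" if "i < n" for i
        using mult_left_mono[OF less_imp_le[OF s(2)[OF that]] l[OF that]] l[OF that] by simp
      then have le: "norm (\<Sum>i<n. l i *\<^sub>R (v i - s i)) \<le> (\<Sum>i<n. l i * (\<epsilon> / 8))"
        by (intro sum_norm_le) simp
      have "t - (\<Sum>i<n. l i *\<^sub>R s i) = (\<Sum>i<n. l i *\<^sub>R (v i - s i))"
        by (simp add: v(2) scaleR_diff_right sum_subtractf)
      moreover have "(\<Sum>i<n. l i * (\<epsilon> / 8)) = \<epsilon> / 8"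
        unfolding sum_distrib_right[symmetric] l1 by simp
      ultimately have "norm (t - (\<Sum>i<n. l i *\<^sub>R s i)) \<le> \<epsilon> / 8" using le by simp
      then show ?thesis using s(1) unfolding T\<^sub>Y_eq by blast
    qed
    have "diameter T \<le> 3 * \<epsilon> / 4"
    proof (rule diameter_le)
      fix t u assume "t \<in> T" "u \<in> T"
      then obtain t' u' where t': "t' \<in> T\<^sub>Y" "norm (t - t') \<le> \<epsilon> / 8"
        and u': "u' \<in> T\<^sub>Y" "norm (u - u') \<le> \<epsilon> / 8"
        using approx by meson
      have "norm (t' - u') < \<epsilon> / 2"
        using diameter_bounded_bound[OF T\<^sub>Y_diam(2) t'(1) u'(1)] T\<^sub>Y_diam(1) by (simp add: dist_norm)
      then show "norm (t - u) \<le> 3 * \<epsilon> / 4"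
        using norm_triangle_ineq[of "t - t'" "t' - u'"] norm_triangle_ineq4[of "t - u'" "u - u'"] t'(2) u'(2)
        by simp
    qed (use \<open>\<epsilon> > 0\<close> in simp)
    then have "vdiameter whole_space T < \<epsilon>"
      using \<open>\<epsilon> > 0\<close> by (simp add: whole_space_def vdiameter_subspace_of_type)
    then show ?thesis using is_convex_comb_if_slice_comb[OF T(1)] by blast
  qed
  then show ?thesis
    unfolding BSCSP_def has_small_convex_combs_of_slices_def ball_X by blast
qed

end
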